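(* Let $(\mathcal{M},\mathbf{c},K)$ be a conformal optical geometry. Let $g$ and $\widehat g$ be two metrics in $\mathbf{c}$, so that $(\mathcal{M},g,K)$ and $(\mathcal{M},\widehat g,K)$ are optical geometries. Let $\mathring{T}$ and $\widehat{\mathring{T}}$ be the intrinsic torsions of the respective optical geometries. Then $$\mathring{T}\in\Gamma(\mathcal{G}^{-1})\iff\widehat{\mathring{T}}\in\Gamma(\widehat{\mathcal{G}}^{-1}),$$ $$\mathring{T}\in\Gamma(\mathcal{N}_{-1}^1)\iff\widehat{\mathring{T}}\in\Gamma(\widehat{\mathcal{N}}_{-1}^1),$$ $$\mathring{T}\in\Gamma(\mathcal{N}_{-1}^2)\iff\widehat{\mathring{T}}\in\Gamma(\widehat{\mathcal{N}}_{-1}^2).$$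
   Context: A conformal optical geometry $(\mathcal{M},\mathbf{c},K)$ is an oriented and time-oriented Lorentzian conformal manifold $(\mathcal{M},\mathbf{c})$ of dimension $n+2$ (metrics in $\mathbf{c}$ being related by $\widehat g=e^{2\varphi}g$, $\varphi$ smooth) with a null line distribution $K\subset T\mathcal{M}$. $K^\perp\supset K$ is the orthogonal complement, $H_K=K^\perp/K$. For $g\in\mathbf{c}$ with Levi-Civita connection $\nabla$, the intrinsic torsion of $(\mathcal{M},g,K)$ is the section $\mathring T$ of $\mathcal{G}=T^*\mathcal{M}\otimes H_K^*\otimes K^*$ given by $\mathring T(v;w+K;k)=g(\nabla_vk,w)$, for $v\in\Gamma(T\mathcal{M})$, $w\in\Gamma(K^\perp)$, $k\in\Gamma(K)$ (this is the projection of the Levi-Civita connection form to $\mathfrak{so}(n+1,1)/\mathfrak{sim}(n)$ in adapted frames). $\mathcal{G}^{-1}=\mathrm{Ann}(K)\otimes H_K^*\otimes K^*$, $\mathcal{G}^0=\mathrm{Ann}(K^\perp)\otimes H_K^*\otimes K^*$, and $\mathcal{G}^{-1}/\mathcal{G}^0\cong H_K^*\otimes H_K^*\otimes K^*$. The subbundles $\mathcal{N}_{-1}^1,\mathcal{N}_{-1}^2\subset\mathcal{G}^{-1}$ consist of those elements whose image $A_{ij}$ in $H_K^*\otimes H_K^*\otimes K^*$ satisfies $A_{[ij]}=0$, respectively has vanishing trace-free symmetric part $A_{(ij)_\circ}=0$ (trace with respect to the screen metric $h$ induced by $g$). Hatted objects are the corresponding ones for $\widehat g$. *)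

theory Defs
  imports "HOL-Analysis.Analysis" "HOL-Library.Function_Algebras" "HOL-Library.Set_Algebras"
begin

section \<open>Pointwise real vector space structure on functions\<close>

text \<open>Tangent vectors will be functionals on real-valued functions; with this instance the
  library notions of linear algebra (span, subspace, ...) apply to them.\<close>

instantiation "fun" :: (type, real_vector) real_vector
begin

definition scaleR_fun_def: "r *\<^sub>R f = (\<lambda>x. r *\<^sub>R f x)"

instance
  by standard (auto simp: scaleR_fun_def fun_eq_iff algebra_simps)

end

definition linear_map_on :: "'v::real_vector set \<Rightarrow> ('v \<Rightarrow> 'w::real_vector) \<Rightarrow> bool" where
  "linear_map_on V f \<longleftrightarrow> (\<forall>x\<in>V. \<forall>y\<in>V. \<forall>a b. f (a *\<^sub>R x + b *\<^sub>R y) = a *\<^sub>R f x + b *\<^sub>R f y)"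

section \<open>Smooth manifolds\<close>

text \<open>Intended for open sets \<open>S\<close>: all iterated directional derivatives up to order \<open>k\<close>
  exist (as total derivatives below order \<open>k\<close>) and are continuous.\<close>

primrec Ck_on :: "nat \<Rightarrow> 'a::real_normed_vector set \<Rightarrow> ('a \<Rightarrow> 'b::real_normed_vector) \<Rightarrow> bool" where
  "Ck_on 0 S f \<longleftrightarrow> continuous_on S f"
| "Ck_on (Suc k) S f \<longleftrightarrow>
     f differentiable_on S \<and> (\<forall>v. Ck_on k S (\<lambda>x. frechet_derivative f (at x) v))"

definition smooth_on :: "'a::real_normed_vector set \<Rightarrow> ('a \<Rightarrow> 'b::real_normed_vector) \<Rightarrow> bool" where
  "smooth_on S f \<longleftrightarrow> (\<forall>k. Ck_on k S f)"

record ('a, 'd::finite) charted_space =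
  space_top :: "'a topology"
  charts :: "('a set \<times> ('a \<Rightarrow> real ^ 'd)) set"

text \<open>The dimension of the manifold is the cardinality of the index type \<open>'d\<close>.
  The atlas is not required to be maximal.\<close>

definition smooth_manifold :: "('a, 'd::finite) charted_space \<Rightarrow> bool" where
  "smooth_manifold M \<longleftrightarrow>
     Hausdorff_space (space_top M) \<and> second_countable (space_top M) \<and>
     (\<Union>(U, x)\<in>charts M. U) = topspace (space_top M) \<and>
     (\<forall>(U, x)\<in>charts M. openin (space_top M) U \<and> open (x ` U) \<and>
        homeomorphic_map (subtopology (space_top M) U) (top_of_set (x ` U)) x) \<and>
     (\<forall>(U, x)\<in>charts M. \<forall>(V, y)\<in>charts M. smooth_on (x ` (U \<inter> V)) (y \<circ> inv_into U x))"

text \<open>An orientation is encoded by the atlas itself: all coordinate changes preserve the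
  standard orientation of the coordinate space.\<close>

definition oriented_manifold :: "('a, 'd::finite) charted_space \<Rightarrow> bool" where
  "oriented_manifold M \<longleftrightarrow> smooth_manifold M \<and>
     (\<forall>(U, x)\<in>charts M. \<forall>(V, y)\<in>charts M. \<forall>p\<in>U \<inter> V.
        det (matrix (frechet_derivative (y \<circ> inv_into U x) (at (x p)))) > 0)"

definition smooth_fun :: "('a, 'd::finite) charted_space \<Rightarrow> 'a set \<Rightarrow> ('a \<Rightarrow> real) \<Rightarrow> bool" where
  "smooth_fun M U f \<longleftrightarrow> openin (space_top M) U \<and>
     (\<forall>(V, x)\<in>charts M. smooth_on (x ` (U \<inter> V)) (f \<circ> inv_into V x))"

definition smooth_near :: "('a, 'd::finite) charted_space \<Rightarrow> 'a \<Rightarrow> ('a \<Rightarrow> real) \<Rightarrow> bool" where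
  "smooth_near M p f \<longleftrightarrow> (\<exists>U. p \<in> U \<and> smooth_fun M U f)"

section \<open>Tangent vectors and vector fields\<close>

text \<open>A tangent vector at \<open>p\<close> is the directional derivative, in some chart around \<open>p\<close>, along
  some coordinate vector \<open>\<xi>\<close>, viewed as a derivation on the functions that are smooth near \<open>p\<close>.
  The value \<open>0\<close> on all other functions makes equality of tangent vectors the intended one.\<close>

type_synonym 'a tvec = "('a \<Rightarrow> real) \<Rightarrow> real"

definition coord_vector ::
  "('a, 'd::finite) charted_space \<Rightarrow> 'a set \<times> ('a \<Rightarrow> real ^ 'd) \<Rightarrow> 'a \<Rightarrow> real ^ 'd \<Rightarrow> 'a tvec" where
  "coord_vector M c p \<xi> = (case c of (U, x) \<Rightarrow> (\<lambda>f.
     if smooth_near M p f then frechet_derivative (f \<circ> inv_into U x) (at (x p)) \<xi> else 0))"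

definition tangent_space :: "('a, 'd::finite) charted_space \<Rightarrow> 'a \<Rightarrow> 'a tvec set" where
  "tangent_space M p = {coord_vector M c p \<xi> | c \<xi>. c \<in> charts M \<and> p \<in> fst c}"

type_synonym 'a vfield = "'a \<Rightarrow> 'a tvec"

definition smooth_vfield :: "('a, 'd::finite) charted_space \<Rightarrow> 'a set \<Rightarrow> 'a vfield \<Rightarrow> bool" where
  "smooth_vfield M U X \<longleftrightarrow> openin (space_top M) U \<and> (\<forall>p\<in>U. X p \<in> tangent_space M p) \<and>
     (\<forall>V f. V \<subseteq> U \<longrightarrow> smooth_fun M V f \<longrightarrow> smooth_fun M V (\<lambda>p. X p f))"

definition smooth_section ::
  "('a, 'd::finite) charted_space \<Rightarrow> ('a \<Rightarrow> 'a tvec set) \<Rightarrow> 'a set \<Rightarrow> 'a vfield \<Rightarrow> bool" where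
  "smooth_section M D U X \<longleftrightarrow> smooth_vfield M U X \<and> (\<forall>p\<in>U. X p \<in> D p)"

definition lie_bracket ::
  "('a, 'd::finite) charted_space \<Rightarrow> 'a vfield \<Rightarrow> 'a vfield \<Rightarrow> 'a vfield" where
  "lie_bracket M X Y p =
     (\<lambda>f. if smooth_near M p f then X p (\<lambda>q. Y q f) - Y p (\<lambda>q. X q f) else 0)"

section \<open>Lorentzian metrics and the Levi-Civita connection\<close>

type_synonym 'a metric_field = "'a \<Rightarrow> 'a tvec \<Rightarrow> 'a tvec \<Rightarrow> real"

text \<open>Signature \<open>(-,+,\<dots>,+)\<close>, so that the metric induced on the screen bundle of a null line
  is positive definite.\<close>

definition lorentzian_metric ::
  "('a, 'd::finite) charted_space \<Rightarrow> 'a metric_field \<Rightarrow> bool" where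
  "lorentzian_metric M g \<longleftrightarrow>
     (\<forall>p\<in>topspace (space_top M).
        (\<forall>v\<in>tangent_space M p. linear_map_on (tangent_space M p) (g p v)) \<and>
        (\<forall>v\<in>tangent_space M p. \<forall>w\<in>tangent_space M p. g p v w = g p w v) \<and>
        (\<exists>(e :: 'd \<Rightarrow> 'a tvec) i0. tangent_space M p = span (range e) \<and>
           (\<forall>i j. g p (e i) (e j) = (if i \<noteq> j then 0 else if i = i0 then -1 else 1)))) \<and>
     (\<forall>U X Y. smooth_vfield M U X \<longrightarrow> smooth_vfield M U Y \<longrightarrow>
        smooth_fun M U (\<lambda>p. g p (X p) (Y p)))"

text \<open>\<open>nabla p v Y\<close> is the covariant derivative at \<open>p\<close>, in direction \<open>v\<close>, of a vector field \<open>Y\<close>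
  defined and smooth on a neighbourhood of \<open>p\<close>.\<close>

type_synonym 'a conn = "'a \<Rightarrow> 'a tvec \<Rightarrow> 'a vfield \<Rightarrow> 'a tvec"

definition affine_connection :: "('a, 'd::finite) charted_space \<Rightarrow> 'a conn \<Rightarrow> bool" where
  "affine_connection M nabla \<longleftrightarrow>
     (\<forall>U X Y. smooth_vfield M U X \<longrightarrow> smooth_vfield M U Y \<longrightarrow>
        smooth_vfield M U (\<lambda>p. nabla p (X p) Y)) \<and>
     (\<forall>U Y. smooth_vfield M U Y \<longrightarrow> (\<forall>p\<in>U.
        (\<forall>v\<in>tangent_space M p. nabla p v Y \<in> tangent_space M p) \<and>
        linear_map_on (tangent_space M p) (\<lambda>v. nabla p v Y))) \<and>
     (\<forall>U Y Z. smooth_vfield M U Y \<longrightarrow> smooth_vfield M U Z \<longrightarrow>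
        (\<forall>p\<in>U. \<forall>v\<in>tangent_space M p. nabla p v (Y + Z) = nabla p v Y + nabla p v Z)) \<and>
     (\<forall>U f Y. smooth_fun M U f \<longrightarrow> smooth_vfield M U Y \<longrightarrow>
        (\<forall>p\<in>U. \<forall>v\<in>tangent_space M p.
           nabla p v (\<lambda>q. f q *\<^sub>R Y q) = v f *\<^sub>R Y p + f p *\<^sub>R nabla p v Y)) \<and>
     (\<forall>U Y Z. smooth_vfield M U Y \<longrightarrow> smooth_vfield M U Z \<longrightarrow> (\<forall>q\<in>U. Y q = Z q) \<longrightarrow>
        (\<forall>p\<in>U. \<forall>v\<in>tangent_space M p. nabla p v Y = nabla p v Z))"

definition levi_civita ::
  "('a, 'd::finite) charted_space \<Rightarrow> 'a metric_field \<Rightarrow> 'a conn \<Rightarrow> bool" where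
  "levi_civita M g nabla \<longleftrightarrow> affine_connection M nabla \<and>
     (\<forall>U X Y. smooth_vfield M U X \<longrightarrow> smooth_vfield M U Y \<longrightarrow>
        (\<forall>p\<in>U. nabla p (X p) Y - nabla p (Y p) X = lie_bracket M X Y p)) \<and>
     (\<forall>U Y Z. smooth_vfield M U Y \<longrightarrow> smooth_vfield M U Z \<longrightarrow>
        (\<forall>p\<in>U. \<forall>v\<in>tangent_space M p.
           v (\<lambda>q. g q (Y q) (Z q)) = g p (nabla p v Y) (Z p) + g p (Y p) (nabla p v Z)))"

section \<open>Conformal optical geometries\<close>

text \<open>Metrics are compared on tangent vectors only; their values elsewhere are irrelevant.\<close>

definition conformal_class ::
  "('a, 'd::finite) charted_space \<Rightarrow> 'a metric_field set \<Rightarrow> bool" where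
  "conformal_class M c \<longleftrightarrow> c \<noteq> {} \<and> (\<forall>g\<in>c. lorentzian_metric M g) \<and>
     (\<forall>g\<in>c. \<forall>h. h \<in> c \<longleftrightarrow> lorentzian_metric M h \<and>
        (\<exists>\<phi>. smooth_fun M (topspace (space_top M)) \<phi> \<and>
           (\<forall>p\<in>topspace (space_top M). \<forall>v\<in>tangent_space M p. \<forall>w\<in>tangent_space M p.
              h p v w = exp (2 * \<phi> p) * g p v w)))"

text \<open>A time orientation selects at each point a future cone \<open>F p\<close>, one of the two
  components of the set of timelike vectors; locally it is the component
  containing a smooth timelike vector field \<open>X\<close>. In signature \<open>(-,+,\<dots>,+)\<close>, timelike \<open>v\<close> and
  \<open>X\<close> lie in the same component iff \<open>g(v, X) < 0\<close>, a condition common to all \<open>g \<in> c\<close>.\<close>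

definition time_orientation ::
  "('a, 'd::finite) charted_space \<Rightarrow> 'a metric_field set \<Rightarrow> ('a \<Rightarrow> 'a tvec set) \<Rightarrow> bool" where
  "time_orientation M c F \<longleftrightarrow> (\<forall>g\<in>c. \<forall>p\<in>topspace (space_top M).
     \<exists>U X. p \<in> U \<and> smooth_vfield M U X \<and> (\<forall>q\<in>U. g q (X q) (X q) < 0 \<and>
        F q = {v \<in> tangent_space M q. g q v v < 0 \<and> g q v (X q) < 0}))"

definition line_distribution ::
  "('a, 'd::finite) charted_space \<Rightarrow> ('a \<Rightarrow> 'a tvec set) \<Rightarrow> bool" where
  "line_distribution M K \<longleftrightarrow> (\<forall>p\<in>topspace (space_top M).
     \<exists>U \<kappa>. p \<in> U \<and> smooth_vfield M U \<kappa> \<and> (\<forall>q\<in>U. \<kappa> q \<noteq> 0 \<and> K q = span {\<kappa> q}))"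

definition conformal_optical_geometry ::
  "nat \<Rightarrow> ('a, 'd::finite) charted_space \<Rightarrow> 'a metric_field set \<Rightarrow>
     ('a \<Rightarrow> 'a tvec set) \<Rightarrow> ('a \<Rightarrow> 'a tvec set) \<Rightarrow> bool" where
  "conformal_optical_geometry n M c F K \<longleftrightarrow>
     CARD('d) = n + 2 \<and> oriented_manifold M \<and> conformal_class M c \<and> time_orientation M c F \<and>
     line_distribution M K \<and>
     (\<forall>g\<in>c. \<forall>p\<in>topspace (space_top M). \<forall>k\<in>K p. g p k k = 0)"

section \<open>The screen bundle and the intrinsic torsion\<close>

definition K_perp ::
  "('a, 'd::finite) charted_space \<Rightarrow> 'a metric_field \<Rightarrow> ('a \<Rightarrow> 'a tvec set) \<Rightarrow> 'a \<Rightarrow> 'a tvec set" where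
  "K_perp M g K p = {v \<in> tangent_space M p. \<forall>k\<in>K p. g p v k = 0}"

text \<open>The fibre of \<open>H\<^sub>K = K\<^sup>\<bottom> / K\<close>; its elements are the cosets \<open>w +o K p\<close>.\<close>

definition screen_space ::
  "('a, 'd::finite) charted_space \<Rightarrow> 'a metric_field \<Rightarrow> ('a \<Rightarrow> 'a tvec set) \<Rightarrow> 'a \<Rightarrow> 'a tvec set set" where
  "screen_space M g K p = (\<lambda>w. w +o K p) ` K_perp M g K p"

definition screen_metric :: "'a metric_field \<Rightarrow> 'a \<Rightarrow> 'a tvec set \<Rightarrow> 'a tvec set \<Rightarrow> real" where
  "screen_metric g p V W = g p (SOME v. v \<in> V) (SOME w. w \<in> W)"

type_synonym 'a torsion_form = "'a tvec \<Rightarrow> 'a tvec set \<Rightarrow> 'a tvec \<Rightarrow> real"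

text \<open>\<open>T(v; w + K; k) = g(\<nabla>\<^sub>v k, w)\<close>. To differentiate, the vector \<open>k \<in> K p\<close> is extended to a
  local smooth section of \<open>K\<close>. As \<open>w\<close> is orthogonal to \<open>K\<close>, and \<open>\<nabla>\<^sub>v\<close> of a (null) section of
  \<open>K\<close> is orthogonal to \<open>K\<close>, the value depends neither on the extension nor on the
  representative \<open>w\<close> of the coset.\<close>

definition intrinsic_torsion ::
  "('a, 'd::finite) charted_space \<Rightarrow> 'a metric_field \<Rightarrow> 'a conn \<Rightarrow> ('a \<Rightarrow> 'a tvec set) \<Rightarrow>
     'a \<Rightarrow> 'a torsion_form" where
  "intrinsic_torsion M g nabla K p v W k =
     g p (nabla p v (SOME \<kappa>. \<kappa> p = k \<and> (\<exists>U. p \<in> U \<and> smooth_section M K U \<kappa>))) (SOME w. w \<in> W)"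

text \<open>The fibre of \<open>\<G> = T\<^sup>*M \<otimes> H\<^sub>K\<^sup>* \<otimes> K\<^sup>*\<close>. Linearity in the second argument refers to the
  quotient vector space structure of \<open>H\<^sub>K\<close>.\<close>

definition G_fibre ::
  "('a, 'd::finite) charted_space \<Rightarrow> 'a metric_field \<Rightarrow> ('a \<Rightarrow> 'a tvec set) \<Rightarrow> 'a \<Rightarrow>
     'a torsion_form set" where
  "G_fibre M g K p = {t.
     (\<forall>W\<in>screen_space M g K p. \<forall>k\<in>K p. linear_map_on (tangent_space M p) (\<lambda>v. t v W k)) \<and>
     (\<forall>v\<in>tangent_space M p. \<forall>k\<in>K p. linear_map_on (K_perp M g K p) (\<lambda>w. t v (w +o K p) k)) \<and>
     (\<forall>v\<in>tangent_space M p. \<forall>W\<in>screen_space M g K p. linear_map_on (K p) (\<lambda>k. t v W k))}"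

text \<open>The space \<open>\<Gamma>(E)\<close> of smooth sections of a subbundle \<open>E\<close> of \<open>\<G>\<close>.\<close>

definition G_sections ::
  "('a, 'd::finite) charted_space \<Rightarrow> 'a metric_field \<Rightarrow> ('a \<Rightarrow> 'a tvec set) \<Rightarrow>
     ('a \<Rightarrow> 'a torsion_form set) \<Rightarrow> ('a \<Rightarrow> 'a torsion_form) set" where
  "G_sections M g K E = {T.
     (\<forall>p\<in>topspace (space_top M). T p \<in> E p) \<and>
     (\<forall>U v w k. smooth_vfield M U v \<longrightarrow> smooth_section M (K_perp M g K) U w \<longrightarrow>
        smooth_section M K U k \<longrightarrow> smooth_fun M U (\<lambda>p. T p (v p) (w p +o K p) (k p)))}"

definition G_minus1 ::
  "('a, 'd::finite) charted_space \<Rightarrow> 'a metric_field \<Rightarrow> ('a \<Rightarrow> 'a tvec set) \<Rightarrow> 'a \<Rightarrow>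
     'a torsion_form set" where
  "G_minus1 M g K p = {t \<in> G_fibre M g K p.
     \<forall>v\<in>K p. \<forall>W\<in>screen_space M g K p. \<forall>k\<in>K p. t v W k = 0}"

text \<open>The image \<open>A\<close> of an element of \<open>\<G>\<^sup>-\<^sup>1\<close> under
  \<open>\<G>\<^sup>-\<^sup>1 \<rightarrow> \<G>\<^sup>-\<^sup>1 / \<G>\<^sup>0 \<cong> H\<^sub>K\<^sup>* \<otimes> H\<^sub>K\<^sup>* \<otimes> K\<^sup>*\<close>: its first argument is restricted to \<open>K\<^sup>\<bottom>\<close>
  and, since \<open>t\<close> annihilates \<open>K\<close> there, factored through \<open>H\<^sub>K\<close>.\<close>

type_synonym 'a screen_form = "'a tvec set \<Rightarrow> 'a tvec set \<Rightarrow> 'a tvec \<Rightarrow> real"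

definition screen_part :: "'a torsion_form \<Rightarrow> 'a screen_form" where
  "screen_part t V W k = t (SOME v. v \<in> V) W k"

definition skew_part :: "'a screen_form \<Rightarrow> 'a screen_form" where
  "skew_part A V W k = (A V W k - A W V k) / 2"

definition sym_part :: "'a screen_form \<Rightarrow> 'a screen_form" where
  "sym_part A V W k = (A V W k + A W V k) / 2"

text \<open>Representatives \<open>e 0, \<dots>, e (n - 1)\<close> in \<open>K\<^sup>\<bottom>\<close> of an orthonormal basis of the screen space.\<close>

definition orthonormal_screen_frame ::
  "nat \<Rightarrow> ('a, 'd::finite) charted_space \<Rightarrow> 'a metric_field \<Rightarrow> ('a \<Rightarrow> 'a tvec set) \<Rightarrow> 'a \<Rightarrow>
     (nat \<Rightarrow> 'a tvec) \<Rightarrow> bool" where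
  "orthonormal_screen_frame n M g K p e \<longleftrightarrow>
     K_perp M g K p = span (e ` {..<n} \<union> K p) \<and>
     (\<forall>i<n. \<forall>j<n. screen_metric g p (e i +o K p) (e j +o K p) = (if i = j then 1 else 0))"

text \<open>The trace with respect to the screen metric; it does not depend on the orthonormal frame.\<close>

definition screen_trace ::
  "nat \<Rightarrow> ('a, 'd::finite) charted_space \<Rightarrow> 'a metric_field \<Rightarrow> ('a \<Rightarrow> 'a tvec set) \<Rightarrow> 'a \<Rightarrow>
     'a screen_form \<Rightarrow> 'a tvec \<Rightarrow> real" where
  "screen_trace n M g K p A k =
     (let e = SOME e. orthonormal_screen_frame n M g K p e
      in \<Sum>i<n. A (e i +o K p) (e i +o K p) k)"

definition tracefree_sym_part ::
  "nat \<Rightarrow> ('a, 'd::finite) charted_space \<Rightarrow> 'a metric_field \<Rightarrow> ('a \<Rightarrow> 'a tvec set) \<Rightarrow> 'a \<Rightarrow>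
     'a screen_form \<Rightarrow> 'a screen_form" where
  "tracefree_sym_part n M g K p A V W k =
     sym_part A V W k - screen_trace n M g K p A k / real n * screen_metric g p V W"

definition N1_minus1 ::
  "('a, 'd::finite) charted_space \<Rightarrow> 'a metric_field \<Rightarrow> ('a \<Rightarrow> 'a tvec set) \<Rightarrow> 'a \<Rightarrow>
     'a torsion_form set" where
  "N1_minus1 M g K p = {t \<in> G_minus1 M g K p.
     \<forall>V\<in>screen_space M g K p. \<forall>W\<in>screen_space M g K p. \<forall>k\<in>K p.
       skew_part (screen_part t) V W k = 0}"

definition N2_minus1 ::
  "nat \<Rightarrow> ('a, 'd::finite) charted_space \<Rightarrow> 'a metric_field \<Rightarrow> ('a \<Rightarrow> 'a tvec set) \<Rightarrow> 'a \<Rightarrow>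
     'a torsion_form set" where
  "N2_minus1 n M g K p = {t \<in> G_minus1 M g K p.
     \<forall>V\<in>screen_space M g K p. \<forall>W\<in>screen_space M g K p. \<forall>k\<in>K p.
       tracefree_sym_part n M g K p (screen_part t) V W k = 0}"

end

theory Submission
  imports Defs
begin

text \<open>
  The torsion-free connections of \<open>g\<close> and \<open>ghat = exp (2 \<phi>) g\<close> differ by a symmetric tensor, and
  compatibility with the two metrics determines it, as in Koszul's formula. Restricted to
  \<open>k \<in> K\<close> and \<open>w \<in> K\<^sup>\<bottom>\<close> this gives
  \<open>That(v; w + K; k) = exp (2 \<phi>) (T(v; w + K; k) + k(\<phi>) g(v, w) - w(\<phi>) g(v, k))\<close>.
  The correction vanishes for \<open>v \<in> K\<close>, and for \<open>v \<in> K\<^sup>\<bottom>\<close> it is the multiple \<open>k(\<phi>)\<close> of the screen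
  metric, hence pure trace: neither the skew part nor the trace-free symmetric part sees it.
  The converse implications exchange the two metrics and replace \<open>\<phi>\<close> by \<open>-\<phi>\<close>.
\<close>

section \<open>Calculus of smooth functions\<close>

text \<open>Membership in \<Gamma> of a subbundle also asks for multilinearity and smoothness.
  Neither is established for the torsion itself: both pass from \<open>T\<close> to
  \<open>That\<close>, because the correction term is linear in each slot and smooth along smooth
  sections.

  The definitions contain unspecified choices. The extension of \<open>k\<close> and the
  representative of \<open>w + K\<close> are chosen without reference to the metric, so both
  torsions use the same ones. The frame in \<open>screen_trace\<close>, however, depends on the
  metric: \<open>g\<close> and \<open>ghat\<close> may choose unrelated frames. Their traces can be
  compared only once orthonormal frames are known to exist and the trace is known not to depend on
  them.

  A tangent vector takes the value 0 on functions that are not smooth near its base point. Leibniz's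
  rule and the derivative of \<open>exp\<close>, on which the metric comparison rests, therefore
  require proofs of smoothness, hence the calculus of \<open>Ck_on\<close>.\<close>

lemma Ck_on_subset: "Ck_on k S f \<Longrightarrow> T \<subseteq> S \<Longrightarrow> Ck_on k T f"
  by (induction k arbitrary: f) (auto intro: continuous_on_subset differentiable_on_subset)

lemma Ck_on_SucD:
  assumes "Ck_on (Suc k) S f" "open S" "x \<in> S"
  shows "(f has_derivative frechet_derivative f (at x)) (at x)"
  using assms by (auto simp: differentiable_on_eq_differentiable_at frechet_derivative_works)

text \<open>On an open set the two functions have the same derivatives at each point.
  \<open>frechet_derivative\<close> chooses among these, so it agrees for both even where no
  derivative exists.\<close>

lemma Ck_on_cong:
  assumes "open S" "\<And>x. x \<in> S \<Longrightarrow> f x = f' x"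
  shows "Ck_on k S f \<longleftrightarrow> Ck_on k S f'"
  using assms(2)
proof (induction k arbitrary: f f')
  case 0
  then show ?case by (simp cong: continuous_on_cong)
next
  case (Suc k)
  have *: "(f has_derivative D) (at x) \<longleftrightarrow> (f' has_derivative D) (at x)" if "x \<in> S" for x D
    using that Suc.prems has_derivative_transform_within_open[OF _ assms(1) that, of f D UNIV f']
      has_derivative_transform_within_open[OF _ assms(1) that, of f' D UNIV f] by auto
  then have "f differentiable_on S \<longleftrightarrow> f' differentiable_on S"
    using assms(1) by (simp add: differentiable_on_eq_differentiable_at differentiable_def)
  moreover have D: "frechet_derivative f (at x) = frechet_derivative f' (at x)" if "x \<in> S" for x
    using *[OF that] by (simp add: frechet_derivative_def)
  have "Ck_on k S (\<lambda>x. frechet_derivative f (at x) v) =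
      Ck_on k S (\<lambda>x. frechet_derivative f' (at x) v)" for v
    by (rule Suc.IH) (simp add: D)
  ultimately show ?case by simp
qed

text \<open>Lets the inductions work with a derivative supplied by a rule of calculus; uniqueness of
  derivatives identifies it with the one chosen by \<open>frechet_derivative\<close>.\<close>

lemma Ck_on_SucI:
  assumes "open S" "\<And>x. x \<in> S \<Longrightarrow> (f has_derivative f' x) (at x)"
    and "\<And>v. Ck_on k S (\<lambda>x. f' x v)"
  shows "Ck_on (Suc k) S f"
proof -
  have "frechet_derivative f (at x) = f' x" if "x \<in> S" for x
    using frechet_derivative_at[OF assms(2)[OF that]] by simp
  then have "Ck_on k S (\<lambda>x. frechet_derivative f (at x) v) = Ck_on k S (\<lambda>x. f' x v)" for v
    using assms(1) by (intro Ck_on_cong) auto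
  with assms(3) have "\<forall>v. Ck_on k S (\<lambda>x. frechet_derivative f (at x) v)"
    by blast
  moreover have "f differentiable_on S"
    using assms(1,2) unfolding differentiable_on_eq_differentiable_at[OF assms(1)] differentiable_def
    by blast
  ultimately show ?thesis by simp
qed

text \<open>The product and chain rules at order \<open>Suc k\<close> leave undifferentiated
  factors, which the induction hypothesis wants at order \<open>k\<close>.\<close>

lemma Ck_on_mono_Suc: "Ck_on (Suc k) S f \<Longrightarrow> Ck_on k S f"
proof (induction k arbitrary: f)
  case 0
  then show ?case by (simp add: differentiable_imp_continuous_on)
next
  case (Suc k)
  from Suc.prems have "f differentiable_on S" "Ck_on (Suc k) S (\<lambda>x. frechet_derivative f (at x) v)" for v
    unfolding Ck_on.simps(2)[of "Suc k"] by blast+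
  with Suc.IH show ?case unfolding Ck_on.simps(2)[of k S f] by blast
qed

lemma Ck_on_const: "open S \<Longrightarrow> Ck_on k S (\<lambda>x. c)"
proof (induction k arbitrary: c)
  case (Suc k)
  then show ?case by (intro Ck_on_SucI[where f' = "\<lambda>x v. 0"]) auto
qed simp

lemma Ck_on_add:
  assumes "open S"
  shows "Ck_on k S f \<Longrightarrow> Ck_on k S h \<Longrightarrow> Ck_on k S (\<lambda>x. f x + h x)"
proof (induction k arbitrary: f h)
  case (Suc k)
  note D = Suc.prems[THEN Ck_on_SucD, OF assms]
  show ?case
  proof (rule Ck_on_SucI[OF assms has_derivative_add[OF D]])
    show "Ck_on k S (\<lambda>x. frechet_derivative f (at x) v + frechet_derivative h (at x) v)" for v
      using Suc.prems by (intro Suc.IH) simp_all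
  qed
qed (simp add: continuous_on_add)

lemma Ck_on_sum:
  assumes "open S"
  shows "(\<And>i. i \<in> I \<Longrightarrow> Ck_on k S (f i)) \<Longrightarrow> Ck_on k S (\<lambda>x. \<Sum>i\<in>I. f i x)"
  by (induction I rule: infinite_finite_induct) (auto intro: Ck_on_add Ck_on_const assms)

lemma Ck_on_bounded_linear:
  assumes "open S" "bounded_linear L"
  shows "Ck_on k S f \<Longrightarrow> Ck_on k S (\<lambda>x. L (f x))"
proof (induction k arbitrary: f)
  case 0
  then show ?case using assms(2) by (simp add: bounded_linear.continuous_on)
next
  case (Suc k)
  note D = Ck_on_SucD[OF Suc.prems assms(1)]
  show ?case
  proof (rule Ck_on_SucI[OF assms(1) bounded_linear.has_derivative[OF assms(2) D]])
    show "Ck_on k S (\<lambda>x. L (frechet_derivative f (at x) v))" for v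
      using Suc.prems by (intro Suc.IH) simp
  qed
qed

lemma Ck_on_mult:
  fixes f h :: "'a::real_normed_vector \<Rightarrow> real"
  assumes "open S"
  shows "Ck_on k S f \<Longrightarrow> Ck_on k S h \<Longrightarrow> Ck_on k S (\<lambda>x. f x * h x)"
proof (induction k arbitrary: f h)
  case (Suc k)
  note D = Suc.prems[THEN Ck_on_SucD, OF assms]
  show ?case
  proof (rule Ck_on_SucI[OF assms has_derivative_mult[OF D]])
    show "Ck_on k S (\<lambda>x. f x * frechet_derivative h (at x) v + frechet_derivative f (at x) v * h x)" for v
      using Suc.prems Suc.prems[THEN Ck_on_mono_Suc]
      by (intro Ck_on_add[OF assms] Suc.IH) simp_all
  qed
qed (simp add: continuous_on_mult)

lemma Ck_on_exp:
  fixes f :: "'a::real_normed_vector \<Rightarrow> real"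
  assumes "open S"
  shows "Ck_on k S f \<Longrightarrow> Ck_on k S (\<lambda>x. exp (f x))"
proof (induction k)
  case (Suc k)
  have D: "((\<lambda>x. exp (f x)) has_derivative (\<lambda>v. exp (f x) * frechet_derivative f (at x) v)) (at x)"
    if "x \<in> S" for x
    using Ck_on_SucD[OF Suc.prems assms that] by (auto intro!: derivative_eq_intros)
  show ?case
  proof (rule Ck_on_SucI[OF assms D])
    show "Ck_on k S (\<lambda>x. exp (f x) * frechet_derivative f (at x) v)" for v
      using Suc.prems Suc.IH[OF Ck_on_mono_Suc[OF Suc.prems]]
      by (intro Ck_on_mult[OF assms]) simp_all
  qed
qed (simp add: continuous_on_exp)

text \<open>The derivative of the outer function is taken in a direction that moves with
  \<open>x\<close>. Expanding this direction in \<open>Basis\<close> leaves a finite sum of products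
  of real functions, where \<open>f\<close> is differentiated only in fixed directions
  \<open>b\<close>; to these derivatives the induction hypothesis applies.\<close>

lemma Ck_on_compose:
  fixes f :: "'b::euclidean_space \<Rightarrow> real" and h :: "'a::real_normed_vector \<Rightarrow> 'b"
  assumes "open S" "open T" "h ` S \<subseteq> T"
  shows "Ck_on k T f \<Longrightarrow> Ck_on k S h \<Longrightarrow> Ck_on k S (\<lambda>x. f (h x))"
proof (induction k arbitrary: f)
  case 0
  then show ?case using assms(3) by (auto intro: continuous_on_compose2)
next
  case (Suc k)
  let ?D = "\<lambda>x v. \<Sum>b\<in>Basis. (frechet_derivative h (at x) v \<bullet> b) * frechet_derivative f (at (h x)) b"
  have D: "((\<lambda>x. f (h x)) has_derivative ?D x) (at x)" if "x \<in> S" for x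
  proof -
    have f: "(f has_derivative frechet_derivative f (at (h x))) (at (h x))"
      using Ck_on_SucD[OF Suc.prems(1) assms(2)] that assms(3) by blast
    have h: "(h has_derivative frechet_derivative h (at x)) (at x)"
      using Ck_on_SucD[OF Suc.prems(2) assms(1) that] .
    interpret linear "frechet_derivative f (at (h x))"
      using f has_derivative_linear by blast
    have "frechet_derivative f (at (h x)) (frechet_derivative h (at x) v) = ?D x v" for v
      by (subst euclidean_representation[of "frechet_derivative h (at x) v", symmetric])
        (simp only: sum scale real_scaleR_def)
    with has_derivative_compose[OF h f] show ?thesis by simp
  qed
  have "Ck_on k S (\<lambda>x. ?D x v)" for v
  proof (intro Ck_on_sum Ck_on_mult assms(1))
    fix b :: 'b
    show "Ck_on k S (\<lambda>x. frechet_derivative h (at x) v \<bullet> b)"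
      using Suc.prems by (intro Ck_on_bounded_linear[OF assms(1) bounded_linear_inner_left]) simp
    show "Ck_on k S (\<lambda>x. frechet_derivative f (at (h x)) b)"
      using Suc.prems Ck_on_mono_Suc[OF Suc.prems(2)]
      by (intro Suc.IH[of "\<lambda>y. frechet_derivative f (at y) b"]) auto
  qed
  with D show ?case by (intro Ck_on_SucI[OF assms(1)]) auto
qed

lemma smooth_on_has_derivative:
  assumes "smooth_on S f" "open S" "x \<in> S"
  shows "(f has_derivative frechet_derivative f (at x)) (at x)"
  using assms Ck_on_SucD[of 0] unfolding smooth_on_def by blast

section \<open>Linear algebra\<close>

text \<open>Coefficients are indexed by \<open>I\<close> rather than by vectors, so \<open>e\<close>
  may take a value repeatedly.\<close>

lemma span_image_finite:
  fixes e :: "'i \<Rightarrow> 'v::real_vector"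
  assumes "finite I" "x \<in> span (e ` I)"
  shows "\<exists>c. x = (\<Sum>i\<in>I. c i *\<^sub>R e i)"
  using assms(2)
proof (induction rule: span_induct_alt)
  case base
  show ?case by (auto intro: exI[of _ "\<lambda>_. 0"])
next
  case (step a y z)
  then obtain c j where "z = (\<Sum>i\<in>I. c i *\<^sub>R e i)" "j \<in> I" "y = e j" by auto
  then have "a *\<^sub>R y + z = (\<Sum>i\<in>I. (c i + (if i = j then a else 0)) *\<^sub>R e i)"
    using assms(1)
    by (simp add: scaleR_left_distrib sum.distrib if_distrib[of "\<lambda>t. t *\<^sub>R _"] sum.delta
        cong: if_cong)
  then show ?case by (rule exI[of _ "\<lambda>i. c i + (if i = j then a else 0)"])
qed

lemma linear_combination_linear:
  "linear (\<lambda>x :: real ^ 'd. \<Sum>i\<in>UNIV. x $ i *\<^sub>R (E i :: 'v::real_vector))"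
  by (rule linearI) (simp_all add: scaleR_left_distrib sum.distrib scaleR_sum_right)

lemma scaleR_fun_apply: "(r *\<^sub>R f) x = r *\<^sub>R f x"
  by (simp add: scaleR_fun_def)

text \<open>Tailored to the torsion formula: \<open>s\<close> is the conformal factor and
  \<open>c\<close> the correction. The equation is required only on \<open>V\<close>, where it is
  known.\<close>

lemma linear_map_on_affine_comb:
  fixes L L' c :: "'v::real_vector \<Rightarrow> real"
  assumes "subspace V" "linear_map_on V L" "linear_map_on V c"
    and "\<And>x. x \<in> V \<Longrightarrow> L' x = s * (L x + c x)"
  shows "linear_map_on V L'"
proof -
  have "a *\<^sub>R x + b *\<^sub>R y \<in> V" if "x \<in> V" "y \<in> V" for x y a b
    using assms(1) that by (simp add: subspace_add subspace_scale)
  with assms(2-4) show ?thesis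
    by (simp add: linear_map_on_def algebra_simps)
qed

section \<open>Smooth functions and tangent vectors on manifolds\<close>

lemma chart_image_open:
  assumes "smooth_manifold M" "(V, x) \<in> charts M" "openin (space_top M) U"
  shows "open (x ` (U \<inter> V))"
proof -
  have V: "open (x ` V)" "homeomorphic_map (subtopology (space_top M) V) (top_of_set (x ` V)) x"
    using assms(1,2) by (auto simp: smooth_manifold_def)
  have "openin (subtopology (space_top M) V) (U \<inter> V)"
    using assms(3) by (auto simp: openin_subtopology)
  then have "openin (top_of_set (x ` V)) (x ` (U \<inter> V))"
    using V(2) homeomorphic_map_openness_eq by blast
  then show ?thesis
    using V(1) openin_open_trans by blast
qed

lemma chart_inj:
  assumes "smooth_manifold M" "(V, x) \<in> charts M"
  shows "inj_on x V"
proof -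
  have "homeomorphic_map (subtopology (space_top M) V) (top_of_set (x ` V)) x" 
     "openin (space_top M) V"
    using assms by (auto simp: smooth_manifold_def)
  then show ?thesis
    by (metis homeomorphic_imp_injective_map openin_subset topspace_subtopology_subset)
qed

lemma smooth_fun_subset:
  assumes "smooth_fun M U f" "V \<subseteq> U" "openin (space_top M) V"
  shows "smooth_fun M V f"
  using assms unfolding smooth_fun_def smooth_on_def
  by (fastforce intro: Ck_on_subset)

lemma smooth_fun_Ck:
  "smooth_fun M U f \<longleftrightarrow> openin (space_top M) U \<and>
    (\<forall>V x k. (V, x) \<in> charts M \<longrightarrow> Ck_on k (x ` (U \<inter> V)) (\<lambda>y. f (inv_into V x y)))"
  by (auto simp: smooth_fun_def smooth_on_def comp_def)

lemma smooth_fun_cong: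
  assumes "smooth_manifold M" "\<And>q. q \<in> U \<Longrightarrow> f q = f' q"
  shows "smooth_fun M U f \<longleftrightarrow> smooth_fun M U f'"
proof -
  have "Ck_on k (x ` (U \<inter> V)) (\<lambda>y. f (inv_into V x y)) =
        Ck_on k (x ` (U \<inter> V)) (\<lambda>y. f' (inv_into V x y))"
    if "openin (space_top M) U" "(V, x) \<in> charts M" for V x k
    using chart_image_open[OF assms(1) that(2,1)] chart_inj[OF assms(1) that(2)] assms(2)
    by (intro Ck_on_cong) auto
  then show ?thesis
    unfolding smooth_fun_Ck by blast
qed

lemma smooth_fun_add:
  assumes "smooth_manifold M" "smooth_fun M U f" "smooth_fun M U h"
  shows "smooth_fun M U (\<lambda>q. f q + h q)"
  using assms(2,3) chart_image_open[OF assms(1)] unfolding smooth_fun_Ck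
  by (auto intro!: Ck_on_add)

lemma smooth_fun_mult:
  assumes "smooth_manifold M" "smooth_fun M U f" "smooth_fun M U h"
  shows "smooth_fun M U (\<lambda>q. f q * h q)"
  using assms(2,3) chart_image_open[OF assms(1)] unfolding smooth_fun_Ck
  by (auto intro!: Ck_on_mult)

lemma smooth_fun_const:
  assumes "smooth_manifold M" "openin (space_top M) U"
  shows "smooth_fun M U (\<lambda>q. a)"
  using assms(2) chart_image_open[OF assms(1)] unfolding smooth_fun_Ck
  by (auto intro!: Ck_on_const)

lemma smooth_fun_cmult:
  assumes "smooth_manifold M" "smooth_fun M U f"
  shows "smooth_fun M U (\<lambda>q. a * f q)"
  using assms by (intro smooth_fun_mult smooth_fun_const) (auto simp: smooth_fun_def)

lemma smooth_fun_exp: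
  assumes "smooth_manifold M" "smooth_fun M U f"
  shows "smooth_fun M U (\<lambda>q. exp (f q))"
  using assms(2) chart_image_open[OF assms(1)] unfolding smooth_fun_Ck
  by (auto intro!: Ck_on_exp)

lemma smooth_fun_near: "p \<in> U \<Longrightarrow> smooth_fun M U f \<Longrightarrow> smooth_near M p f"
  unfolding smooth_near_def by blast

lemma smooth_near_has_derivative:
  assumes "smooth_manifold M" "(U, x) \<in> charts M" "p \<in> U" "smooth_near M p f"
  shows "((f \<circ> inv_into U x) has_derivative frechet_derivative (f \<circ> inv_into U x) (at (x p))) (at (x p))"
proof -
  obtain U' where U': "p \<in> U'" "smooth_fun M U' f" "openin (space_top M) U'"
    using assms(4) by (auto simp: smooth_near_def smooth_fun_def)
  have "smooth_on (x ` (U' \<inter> U)) (f \<circ> inv_into U x)"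
    using U' assms(2) by (auto simp: smooth_fun_def)
  then show ?thesis
    using U' assms(3) chart_image_open[OF assms(1,2) U'(3)]
    by (auto intro!: smooth_on_has_derivative)
qed

text \<open>Needed because \<open>coord_vector\<close> tests smoothness near \<open>p\<close>: a
  tangent vector is local only if this test gives the same answer for functions that agree near
  \<open>p\<close>.\<close>

lemma smooth_near_cong:
  assumes "smooth_manifold M" "openin (space_top M) U" "p \<in> U" "\<And>q. q \<in> U \<Longrightarrow> f q = f' q"
    and "smooth_near M p f"
  shows "smooth_near M p f'"
proof -
  obtain W where W: "p \<in> W" "smooth_fun M W f"
    using assms(5) by (auto simp: smooth_near_def)
  then have "smooth_fun M (W \<inter> U) f"
    using assms(2) by (intro smooth_fun_subset[OF W(2)]) (auto simp: smooth_fun_def)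
  then have "smooth_fun M (W \<inter> U) f'"
    using smooth_fun_cong[OF assms(1)] assms(4) by (metis IntD2)
  then show ?thesis
    using W(1) assms(3) unfolding smooth_near_def by blast
qed

section \<open>Tangent vectors as local derivations\<close>

lemma tangent_cong:
  assumes "smooth_manifold M" "v \<in> tangent_space M p"
    and "openin (space_top M) U" "p \<in> U" "\<And>q. q \<in> U \<Longrightarrow> f q = f' q"
  shows "v f = v f'"
proof -
  obtain V x \<xi> where V: "(V, x) \<in> charts M" "p \<in> V" and v: "v = coord_vector M (V, x) p \<xi>"
    using assms(2) by (auto simp: tangent_space_def)
  show ?thesis
  proof (cases "smooth_near M p f")
    case True
    then have near: "smooth_near M p f'"
      using smooth_near_cong[OF assms(1,3,4), of f f'] assms(5) by simp
    have "((f \<circ> inv_into V x) has_derivative frechet_derivative (f' \<circ> inv_into V x) (at (x p))) (at (x p))"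
      using smooth_near_has_derivative[OF assms(1) V near]
    proof (rule has_derivative_transform_within_open)
      show "open (x ` (U \<inter> V))" using chart_image_open[OF assms(1) V(1) assms(3)] .
    qed (use assms V chart_inj[OF assms(1) V(1)] in auto)
    from frechet_derivative_at[OF this] show ?thesis
      using True near by (simp add: v coord_vector_def)
  next
    case False
    then have "\<not> smooth_near M p f'"
      using smooth_near_cong[OF assms(1,3,4), of f' f] assms(5) by auto
    with False show ?thesis by (simp add: v coord_vector_def)
  qed
qed

lemma tangent_mult:
  assumes "smooth_manifold M" "v \<in> tangent_space M p" "p \<in> U" "smooth_fun M U f" "smooth_fun M U h"
  shows "v (\<lambda>q. f q * h q) = f p * v h + v f * h p"
proof -
  obtain V x \<xi> where V: "(V, x) \<in> charts M" "p \<in> V" and v: "v = coord_vector M (V, x) p \<xi>"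
    using assms(2) by (auto simp: tangent_space_def)
  have near: "smooth_near M p f" "smooth_near M p h" "smooth_near M p (\<lambda>q. f q * h q)"
    using assms(3) assms(4,5) smooth_fun_mult[OF assms(1,4,5)] by (blast intro: smooth_fun_near)+
  have xp: "inv_into V x (x p) = p"
    using chart_inj[OF assms(1) V(1)] V(2) by simp
  have "((\<lambda>q. f q * h q) \<circ> inv_into V x has_derivative (\<lambda>\<xi>. f p * v' h \<xi> + v' f \<xi> * h p)) (at (x p))"
    if "v' = (\<lambda>f. frechet_derivative (f \<circ> inv_into V x) (at (x p)))" for v'
    using has_derivative_mult[OF smooth_near_has_derivative[OF assms(1) V near(1)]
       smooth_near_has_derivative[OF assms(1) V near(2)]]
    by (simp add: that comp_def xp)
  note D = frechet_derivative_at[OF this[OF refl], symmetric]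
  show ?thesis
    using near by (simp add: v coord_vector_def D)
qed

lemma tangent_exp:
  assumes "smooth_manifold M" "v \<in> tangent_space M p" "p \<in> U" "smooth_fun M U f"
  shows "v (\<lambda>q. exp (a * f q)) = a * exp (a * f p) * v f"
proof -
  obtain V x \<xi> where V: "(V, x) \<in> charts M" "p \<in> V" and v: "v = coord_vector M (V, x) p \<xi>"
    using assms(2) by (auto simp: tangent_space_def)
  have near: "smooth_near M p f" "smooth_near M p (\<lambda>q. exp (a * f q))"
    using assms(3,4) smooth_fun_exp[OF assms(1) smooth_fun_cmult[OF assms(1,4)]]
    by (blast intro: smooth_fun_near)+
  have xp: "inv_into V x (x p) = p"
    using chart_inj[OF assms(1) V(1)] V(2) by simp
  have "((\<lambda>q. exp (a * f q)) \<circ> inv_into V x has_derivative 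
     (\<lambda>\<xi>. a * exp (a * f p) * frechet_derivative (f \<circ> inv_into V x) (at (x p)) \<xi>)) (at (x p))"
    using smooth_near_has_derivative[OF assms(1) V near(1)] 
    unfolding comp_def by (auto intro!: derivative_eq_intros simp: xp)
  note D = frechet_derivative_at[OF this, symmetric]
  show ?thesis
    using near by (simp add: v coord_vector_def D)
qed

section \<open>Smooth vector fields and connections\<close>

lemma smooth_vfield_subset:
  assumes "smooth_vfield M U X" "V \<subseteq> U" "openin (space_top M) V"
  shows "smooth_vfield M V X"
  using assms unfolding smooth_vfield_def by (meson order_trans subsetD)

text \<open>The field has constant coefficients in its own chart, but smoothness is tested in all
  charts. There the derivative of \<open>f\<close> appears composed with a coordinate change, which
  is smooth by the atlas axiom.\<close>

lemma smooth_vfield_coord: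
  assumes "smooth_manifold M" "(U, x) \<in> charts M"
  shows "smooth_vfield M U (\<lambda>q. coord_vector M (U, x) q \<xi>)"
  unfolding smooth_vfield_def
proof (intro conjI allI impI ballI)
  show "openin (space_top M) U"
    using assms by (auto simp: smooth_manifold_def)
  show "coord_vector M (U, x) q \<xi> \<in> tangent_space M q" if "q \<in> U" for q
    using assms(2) that unfolding tangent_space_def by auto
  fix V f assume VU: "V \<subseteq> U" and f: "smooth_fun M V f"
  then have V: "openin (space_top M) V" by (simp add: smooth_fun_def)
  define h where "h = (\<lambda>y. frechet_derivative (f \<circ> inv_into U x) (at y) \<xi>)"
  \<comment> \<open>\<open>f\<close> is smooth on the whole of \<open>V\<close>, so the default
    value 0 of \<open>coord_vector\<close> never occurs.\<close>
  have eq: "coord_vector M (U, x) q \<xi> f = h (x q)" if "q \<in> V" for q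
    using that f unfolding coord_vector_def h_def smooth_near_def by auto
  have "smooth_fun M V (\<lambda>q. h (x q))"
    unfolding smooth_fun_Ck
  proof (intro conjI allI impI V)
    fix W y k assume W: "(W, y) \<in> charts M"
    have "Ck_on (Suc k) (x ` (V \<inter> U)) (f \<circ> inv_into U x)"
      using f assms(2) unfolding smooth_fun_def smooth_on_def by blast
    then have "Ck_on k (x ` (V \<inter> U)) h" by (simp add: h_def)
    moreover have "Ck_on k (y ` (V \<inter> W)) (x \<circ> inv_into W y)"
    proof (rule Ck_on_subset)
      show "Ck_on k (y ` (W \<inter> U)) (x \<circ> inv_into W y)"
        using assms W by (fastforce simp: smooth_manifold_def smooth_on_def)
    qed (use VU in auto)
    moreover have "(x \<circ> inv_into W y) ` (y ` (V \<inter> W)) \<subseteq> x ` (V \<inter> U)"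
      using VU chart_inj[OF assms(1) W] by auto
    ultimately have "Ck_on k (y ` (V \<inter> W)) (\<lambda>z. h ((x \<circ> inv_into W y) z))"
      by (intro Ck_on_compose[OF chart_image_open[OF assms(1) W V] chart_image_open[OF assms V]])
    then show "Ck_on k (y ` (V \<inter> W)) (\<lambda>z. h (x (inv_into W y z)))" by simp
  qed
  moreover have "smooth_fun M V (\<lambda>q. coord_vector M (U, x) q \<xi> f) = smooth_fun M V (\<lambda>q. h (x q))"
    by (rule smooth_fun_cong[OF assms(1)]) (rule eq)
  ultimately show "smooth_fun M V (\<lambda>q. coord_vector M (U, x) q \<xi> f)" by simp
qed

text \<open>The axioms of \<open>levi_civita\<close> speak of vector fields on open sets, whereas
  the torsion is evaluated at vectors of a single point.\<close>

lemma tangent_extension: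
  assumes "smooth_manifold M" "v \<in> tangent_space M p"
  obtains U X where "p \<in> U" "smooth_vfield M U X" "X p = v"
proof -
  obtain U x \<xi> where "(U, x) \<in> charts M" "p \<in> U" "v = coord_vector M (U, x) p \<xi>"
    using assms(2) by (auto simp: tangent_space_def)
  then show ?thesis
    using smooth_vfield_coord[OF assms(1), of U x \<xi>] by (intro that) simp_all
qed

lemma affine_connection_tangent:
  assumes "affine_connection M nabla" "smooth_vfield M U Y" "p \<in> U" "v \<in> tangent_space M p"
  shows "nabla p v Y \<in> tangent_space M p"
proof -
  have "\<forall>U Y. smooth_vfield M U Y \<longrightarrow> (\<forall>p\<in>U.
        (\<forall>v\<in>tangent_space M p. nabla p v Y \<in> tangent_space M p) \<and>
        linear_map_on (tangent_space M p) (\<lambda>v. nabla p v Y))"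
    using assms(1) unfolding affine_connection_def by (elim conjE)
  with assms(2-4) show ?thesis by blast
qed

lemma levi_civita_torsion_free:
  assumes "levi_civita M g nabla" "smooth_vfield M U X" "smooth_vfield M U Y" "p \<in> U"
  shows "nabla p (X p) Y - nabla p (Y p) X = lie_bracket M X Y p"
proof -
  have "\<forall>U X Y. smooth_vfield M U X \<longrightarrow> smooth_vfield M U Y \<longrightarrow>
        (\<forall>p\<in>U. nabla p (X p) Y - nabla p (Y p) X = lie_bracket M X Y p)"
    using assms(1) unfolding levi_civita_def by (elim conjE)
  with assms(2-4) show ?thesis by blast
qed

lemma levi_civita_metric:
  assumes "levi_civita M g nabla" "smooth_vfield M U Y" "smooth_vfield M U Z" "p \<in> U"
    and "v \<in> tangent_space M p"
  shows "v (\<lambda>q. g q (Y q) (Z q)) = g p (nabla p v Y) (Z p) + g p (Y p) (nabla p v Z)"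
proof -
  have "\<forall>U Y Z. smooth_vfield M U Y \<longrightarrow> smooth_vfield M U Z \<longrightarrow>
        (\<forall>p\<in>U. \<forall>v\<in>tangent_space M p.
           v (\<lambda>q. g q (Y q) (Z q)) = g p (nabla p v Y) (Z p) + g p (Y p) (nabla p v Z))"
    using assms(1) unfolding levi_civita_def by (elim conjE)
  with assms(2-5) show ?thesis by blast
qed

lemma smooth_vfield_points: "smooth_vfield M U X \<Longrightarrow> p \<in> U \<Longrightarrow> p \<in> topspace (space_top M)"
  unfolding smooth_vfield_def using openin_subset by blast

lemma smooth_vfield_tangent: "smooth_vfield M U X \<Longrightarrow> p \<in> U \<Longrightarrow> X p \<in> tangent_space M p"
  by (simp add: smooth_vfield_def)

lemma smooth_vfield_scale:
  assumes "smooth_manifold M" "smooth_vfield M U X" "\<And>p. p \<in> U \<Longrightarrow> subspace (tangent_space M p)"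
  shows "smooth_vfield M U (\<lambda>p. a *\<^sub>R X p)"
  unfolding smooth_vfield_def
proof (intro conjI allI impI ballI)
  show "openin (space_top M) U" using assms(2) by (simp add: smooth_vfield_def)
  show "a *\<^sub>R X p \<in> tangent_space M p" if "p \<in> U" for p
    using that smooth_vfield_tangent[OF assms(2) that] assms(3) by (simp add: subspace_scale)
  fix V f assume "V \<subseteq> U" "smooth_fun M V f"
  then have "smooth_fun M V (\<lambda>p. X p f)"
    using assms(2) by (simp add: smooth_vfield_def)
  from smooth_fun_cmult[OF assms(1) this, of a] show "smooth_fun M V (\<lambda>p. (a *\<^sub>R X p) f)"
    by (simp add: scaleR_fun_apply)
qed

section \<open>Null lines and screen spaces\<close>

text \<open>Only one metric is fixed, so that all results can be reused for
  \<open>ghat\<close>.\<close>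

locale optical_geometry =
  fixes n :: nat and M :: "('a, 'd::finite) charted_space" and K :: "'a \<Rightarrow> 'a tvec set"
    and g :: "'a metric_field"
  assumes manifold: "smooth_manifold M"
    and dim: "CARD('d) = n + 2"
    and lorentzian: "lorentzian_metric M g"
    and line: "line_distribution M K"
    and null: "\<And>p k. p \<in> topspace (space_top M) \<Longrightarrow> k \<in> K p \<Longrightarrow> g p k k = 0"
begin

abbreviation points :: "'a set" where "points \<equiv> topspace (space_top M)"

lemma tangent_subspace: "p \<in> points \<Longrightarrow> subspace (tangent_space M p)"
  using lorentzian by (auto simp: lorentzian_metric_def)

lemma metric_sym:
  "p \<in> points \<Longrightarrow> v \<in> tangent_space M p \<Longrightarrow> w \<in> tangent_space M p \<Longrightarrow> g p v w = g p w v"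
  using lorentzian by (auto simp: lorentzian_metric_def)

lemma metric_lin_right:
  assumes "p \<in> points" "v \<in> tangent_space M p" "x \<in> tangent_space M p" "y \<in> tangent_space M p"
  shows "g p v (a *\<^sub>R x + b *\<^sub>R y) = a * g p v x + b * g p v y"
  using lorentzian assms by (auto simp: lorentzian_metric_def linear_map_on_def)

lemma metric_lin_left:
  assumes "p \<in> points" "v \<in> tangent_space M p" "x \<in> tangent_space M p" "y \<in> tangent_space M p"
  shows "g p (a *\<^sub>R x + b *\<^sub>R y) v = a * g p x v + b * g p y v"
  using assms metric_lin_right metric_sym
  by (metis subspace_add subspace_scale tangent_subspace)

lemma metric_add_right:
  assumes "p \<in> points" "v \<in> tangent_space M p" "x \<in> tangent_space M p" "y \<in> tangent_space M p"
  shows "g p v (x + y) = g p v x + g p v y"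
  using metric_lin_right[OF assms, of 1 1] by simp

lemma metric_add_left:
  assumes "p \<in> points" "v \<in> tangent_space M p" "x \<in> tangent_space M p" "y \<in> tangent_space M p"
  shows "g p (x + y) v = g p x v + g p y v"
  using metric_lin_left[OF assms, of 1 1] by simp

lemma metric_diff_left:
  assumes "p \<in> points" "v \<in> tangent_space M p" "x \<in> tangent_space M p" "y \<in> tangent_space M p"
  shows "g p (x - y) v = g p x v - g p y v"
  using metric_lin_left[OF assms, of 1 "-1"] by simp

lemma metric_scale_right:
  assumes "p \<in> points" "v \<in> tangent_space M p" "x \<in> tangent_space M p"
  shows "g p v (a *\<^sub>R x) = a * g p v x"
  using metric_lin_right[OF assms assms(3), of a 0] by simp

lemma metric_scale_left:
  assumes "p \<in> points" "v \<in> tangent_space M p" "x \<in> tangent_space M p"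
  shows "g p (a *\<^sub>R x) v = a * g p x v"
  using metric_lin_left[OF assms assms(3), of a 0] by simp

lemma metric_sum_right:
  assumes "p \<in> points" "v \<in> tangent_space M p" "\<And>i. i \<in> I \<Longrightarrow> x i \<in> tangent_space M p"
  shows "g p v (\<Sum>i\<in>I. x i) = (\<Sum>i\<in>I. g p v (x i))"
  using assms(3)
proof (induction I rule: infinite_finite_induct)
  case (insert i I)
  then have "g p v (x i + sum x I) = g p v (x i) + g p v (sum x I)"
    using assms(1,2) tangent_subspace by (intro metric_add_right subspace_sum) auto
  with insert show ?case by (metis insertCI sum.insert)
\<comment> \<open>An empty or infinite index set gives the sum 0, which is
  \<open>0 *\<^sub>R v\<close>.\<close>
qed (use metric_scale_right[OF assms(1,2,2), of 0] in simp_all)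

lemma metric_sum_left:
  assumes "p \<in> points" "v \<in> tangent_space M p" "\<And>i. i \<in> I \<Longrightarrow> x i \<in> tangent_space M p"
  shows "g p (\<Sum>i\<in>I. x i) v = (\<Sum>i\<in>I. g p (x i) v)"
proof -
  have "sum x I \<in> tangent_space M p"
    using assms tangent_subspace by (intro subspace_sum) auto
  then have "g p (sum x I) v = g p v (sum x I)"
    using assms(1,2) by (intro metric_sym)
  also have "\<dots> = (\<Sum>i\<in>I. g p v (x i))"
    using assms by (intro metric_sum_right)
  also have "\<dots> = (\<Sum>i\<in>I. g p (x i) v)"
    using assms by (intro sum.cong metric_sym) auto
  finally show ?thesis .
qed

lemma metric_combination_left:
  assumes "p \<in> points" "v \<in> tangent_space M p" "\<And>i. i \<in> I \<Longrightarrow> x i \<in> tangent_space M p"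
  shows "g p (\<Sum>i\<in>I. c i *\<^sub>R x i) v = (\<Sum>i\<in>I. c i * g p (x i) v)"
proof -
  have "g p (\<Sum>i\<in>I. c i *\<^sub>R x i) v = (\<Sum>i\<in>I. g p (c i *\<^sub>R x i) v)"
    using assms tangent_subspace by (intro metric_sum_left) (auto simp: subspace_scale)
  also have "\<dots> = (\<Sum>i\<in>I. c i * g p (x i) v)"
    using assms by (intro sum.cong refl metric_scale_left)
  finally show ?thesis .
qed

section \<open>The null line, its orthogonal complement and cosets\<close>

lemma K_generator:
  assumes "p \<in> points"
  obtains \<kappa> where "\<kappa> \<in> tangent_space M p" "\<kappa> \<noteq> 0" "K p = range (\<lambda>a. a *\<^sub>R \<kappa>)"
  using line assms unfolding line_distribution_def smooth_vfield_def span_singleton by metis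

lemma K_tangent:
  assumes "p \<in> points" "k \<in> K p"
  shows "k \<in> tangent_space M p"
proof -
  obtain \<kappa> where "\<kappa> \<in> tangent_space M p" "K p = range (\<lambda>a. a *\<^sub>R \<kappa>)"
    using K_generator[OF assms(1)] .
  then show ?thesis
    using assms tangent_subspace by (auto simp: subspace_scale)
qed

lemma K_subspace: "p \<in> points \<Longrightarrow> subspace (K p)"
  by (erule K_generator) (simp flip: span_singleton)

text \<open>Nullity is assumed for single vectors; on a line it passes to pairs, since
  \<open>k\<close> and \<open>l\<close> are multiples of one null vector.\<close>

lemma K_null:
  assumes "p \<in> points" "k \<in> K p" "l \<in> K p"
  shows "g p k l = 0"
proof -
  obtain \<kappa> where \<kappa>: "\<kappa> \<in> tangent_space M p" "\<kappa> \<noteq> 0" "K p = range (\<lambda>a. a *\<^sub>R \<kappa>)"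
    using K_generator[OF assms(1)] .
  then have "g p \<kappa> \<kappa> = 0"
    using null[OF assms(1), of \<kappa>] by (metis rangeI scaleR_one)
  then show ?thesis
    using \<kappa> assms tangent_subspace[OF assms(1)]
    by (auto simp: metric_scale_left metric_scale_right subspace_scale)
qed

lemma K_perp_tangent: "w \<in> K_perp M g K p \<Longrightarrow> w \<in> tangent_space M p"
  by (simp add: K_perp_def)

lemma K_perp_orthogonal:
  assumes "p \<in> points" "w \<in> K_perp M g K p" "k \<in> K p"
  shows "g p w k = 0" "g p k w = 0"
  using assms metric_sym[of p k w] K_tangent by (auto simp: K_perp_def)

lemma K_subset_K_perp: "p \<in> points \<Longrightarrow> k \<in> K p \<Longrightarrow> k \<in> K_perp M g K p"
  by (simp add: K_perp_def K_tangent K_null)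

lemma K_perp_subspace:
  assumes "p \<in> points"
  shows "subspace (K_perp M g K p)"
proof (rule subspaceI)
  note T = tangent_subspace[OF assms]
  have "g p 0 k = 0" if "k \<in> K p" for k
    using metric_scale_left[OF assms K_tangent[OF assms that] subspace_0[OF T], of 0] by simp
  then show "0 \<in> K_perp M g K p"
    using subspace_0[OF T] by (simp add: K_perp_def)
  show "x + y \<in> K_perp M g K p" if "x \<in> K_perp M g K p" "y \<in> K_perp M g K p" for x y
    using that T by (simp add: K_perp_def subspace_add metric_add_left[OF assms] K_tangent[OF assms])
  show "a *\<^sub>R x \<in> K_perp M g K p" if "x \<in> K_perp M g K p" for a x
    using that T by (simp add: K_perp_def subspace_scale metric_scale_left[OF assms] K_tangent[OF assms])
qed

text \<open>Definitions on cosets use \<open>SOME\<close>; this confines the unknown to a vector of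
  \<open>K p\<close>.\<close>

lemma coset_some:
  assumes "p \<in> points"
  obtains k where "k \<in> K p" "(SOME v. v \<in> w +o K p) = w + k"
proof -
  have "w \<in> w +o K p"
    using subspace_0[OF K_subspace[OF assms]] by (force simp: elt_set_plus_def)
  then have "(SOME v. v \<in> w +o K p) \<in> w +o K p"
    using someI[of "\<lambda>v. v \<in> w +o K p" w] by simp
  then show ?thesis using that by (auto simp: elt_set_plus_def)
qed

lemma coset_absorb:
  assumes "p \<in> points" "k \<in> K p"
  shows "(w + k) +o K p = w +o K p"
proof -
  have "(w + k) + l \<in> w +o K p" if "l \<in> K p" for l
    using K_subspace[OF assms(1)] assms(2) that
    by (auto simp: elt_set_plus_def add.assoc subspace_add intro!: bexI[of _ "k + l"])
  moreover have "w + l \<in> (w + k) +o K p" if "l \<in> K p" for l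
    using K_subspace[OF assms(1)] assms(2) that
    by (auto simp: elt_set_plus_def subspace_diff intro!: bexI[of _ "l - k"])
  ultimately show ?thesis
    unfolding elt_set_plus_def by blast
qed

text \<open>All other terms vanish, as \<open>K\<close> is orthogonal to \<open>K_perp\<close> and
  to itself. This is why the metric descends to the screen space.\<close>

lemma metric_K_perp_absorb:
  assumes "p \<in> points" "v \<in> K_perp M g K p" "w \<in> K_perp M g K p" "k \<in> K p" "l \<in> K p"
  shows "g p (v + k) (w + l) = g p v w"
  using assms K_perp_subspace[OF assms(1)]
  by (simp add: metric_add_left metric_add_right K_perp_tangent K_tangent K_perp_orthogonal K_null
      subspace_add K_subset_K_perp)

lemma screen_metric_coset:
  assumes "p \<in> points" "v \<in> K_perp M g K p" "w \<in> K_perp M g K p"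
  shows "screen_metric g p (v +o K p) (w +o K p) = g p v w"
proof -
  obtain k where k: "k \<in> K p" "(SOME x. x \<in> v +o K p) = v + k"
    using coset_some[OF assms(1)] .
  obtain l where l: "l \<in> K p" "(SOME x. x \<in> w +o K p) = w + l"
    using coset_some[OF assms(1)] .
  from k l show ?thesis
    using metric_K_perp_absorb[OF assms] by (simp add: screen_metric_def)
qed

section \<open>Orthonormal screen frames and traces\<close>

lemma orthonormal_screen_frame_mem:
  assumes "orthonormal_screen_frame n M g K p e" "i < n"
  shows "e i \<in> K_perp M g K p"
proof -
  have "e i \<in> span (e ` {..<n} \<union> K p)"
    using assms(2) by (intro span_base) simp
  with assms(1) show ?thesis by (simp add: orthonormal_screen_frame_def)
qed

lemma orthonormal_screen_frame_metric:
  assumes "p \<in> points" "orthonormal_screen_frame n M g K p e" "i < n" "j < n"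
  shows "g p (e i) (e j) = (if i = j then 1 else 0)"
  using assms(2,3,4) screen_metric_coset[OF assms(1) assms(2)[THEN orthonormal_screen_frame_mem]
      assms(2)[THEN orthonormal_screen_frame_mem], OF assms(3,4)]
  by (simp add: orthonormal_screen_frame_def)

text \<open>Pairing with \<open>e j\<close> isolates the coefficient of \<open>e j\<close>, because
  \<open>K\<close> is orthogonal to the frame. The remainder \<open>k\<close> stays, as the frame
  represents a basis of the quotient only.\<close>

lemma orthonormal_screen_frame_expand:
  assumes "p \<in> points" "orthonormal_screen_frame n M g K p e" "w \<in> K_perp M g K p"
  obtains k where "k \<in> K p" "w = (\<Sum>i<n. g p w (e i) *\<^sub>R e i) + k"
proof -
  have "w \<in> span (e ` {..<n} \<union> K p)"
    using assms(2,3) by (simp add: orthonormal_screen_frame_def)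
  then obtain x k where x: "x \<in> span (e ` {..<n})" and k: "k \<in> K p" and w: "w = x + k"
    unfolding span_Un using K_subspace[OF assms(1)] by (auto simp: span_eq_iff[THEN iffD2])
  obtain c where c: "x = (\<Sum>i<n. c i *\<^sub>R e i)"
    using span_image_finite[OF _ x] by auto
  note mem = orthonormal_screen_frame_mem[OF assms(2)]
  have T: "c i *\<^sub>R e i \<in> tangent_space M p" "e i \<in> tangent_space M p" if "i < n" for i
    using mem[OF that] tangent_subspace[OF assms(1)] by (auto simp: K_perp_tangent subspace_scale)
  have xT: "x \<in> tangent_space M p"
    unfolding c using T(1) tangent_subspace[OF assms(1)] by (intro subspace_sum) auto
  have "g p w (e j) = c j" if "j < n" for j
  proof -
    have "g p w (e j) = g p x (e j)"
      using metric_add_left[OF assms(1) T(2)[OF that] xT K_tangent[OF assms(1) k]]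
        K_perp_orthogonal(2)[OF assms(1) mem[OF that] k] by (simp add: w)
    also have "\<dots> = (\<Sum>i<n. c i * g p (e i) (e j))"
      unfolding c using T(2) that by (intro metric_combination_left[OF assms(1)]) auto
    also have "\<dots> = (\<Sum>i<n. if i = j then c i else 0)"
      using orthonormal_screen_frame_metric[OF assms(1,2) _ that] by (intro sum.cong) auto
    finally show ?thesis using that by simp
  qed
  then have "(\<Sum>i<n. g p w (e i) *\<^sub>R e i) = x"
    unfolding c by (intro sum.cong) auto
  with w have "w = (\<Sum>i<n. g p w (e i) *\<^sub>R e i) + k"
    by simp
  with k show ?thesis by (rule that)
qed

text \<open>A form on \<open>K_perp\<close> that kills \<open>K\<close> is a form on the screen
  space, so the remainder of the frame expansion is invisible to it.\<close>

lemma linear_form_expand: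
  assumes "p \<in> points" "orthonormal_screen_frame n M g K p e" "w \<in> K_perp M g K p"
    and "linear_map_on (K_perp M g K p) L" "\<And>k. k \<in> K p \<Longrightarrow> L k = 0"
  shows "L w = (\<Sum>i<n. g p w (e i) * L (e i))"
proof -
  note mem = orthonormal_screen_frame_mem[OF assms(2)]
  have sum_mem: "(\<Sum>i\<in>I. c i *\<^sub>R e i) \<in> K_perp M g K p" if "I \<subseteq> {..<n}" for I c
    using mem that K_perp_subspace[OF assms(1)] by (intro subspace_sum subspace_scale) auto
  have add: "L (a *\<^sub>R x + b *\<^sub>R y) = a * L x + b * L y"
    if "x \<in> K_perp M g K p" "y \<in> K_perp M g K p" for x y a b
    using assms(4) that by (simp add: linear_map_on_def)
  have sum: "L (\<Sum>i\<in>I. c i *\<^sub>R e i) = (\<Sum>i\<in>I. c i * L (e i))" if "finite I" "I \<subseteq> {..<n}" for I c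
    using that
  proof (induction I rule: finite_induct)
    case empty
    show ?case
      unfolding sum.empty by (rule assms(5)[OF subspace_0[OF K_subspace[OF assms(1)]]])
  next
    case (insert i I)
    \<comment> \<open>\<open>linear_map_on\<close> concerns two-term combinations only, hence the
      coefficient 1 and the induction over the sum.\<close>
    then have "L (c i *\<^sub>R e i + 1 *\<^sub>R (\<Sum>i\<in>I. c i *\<^sub>R e i)) = c i * L (e i) + 1 * L (\<Sum>i\<in>I. c i *\<^sub>R e i)"
      by (intro add mem sum_mem) auto
    moreover have "L (\<Sum>i\<in>I. c i *\<^sub>R e i) = (\<Sum>i\<in>I. c i * L (e i))"
      using insert by auto
    ultimately show ?case
      by (simp only: sum.insert[OF insert.hyps] scaleR_one mult_1)
  qed
  obtain k where k: "k \<in> K p" and w: "w = (\<Sum>i<n. g p w (e i) *\<^sub>R e i) + k"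
    using orthonormal_screen_frame_expand[OF assms(1-3)] .
  let ?s = "\<Sum>i<n. g p w (e i) *\<^sub>R e i"
  have "L (1 *\<^sub>R ?s + 1 *\<^sub>R k) = 1 * L ?s + 1 * L k"
    using k by (intro add sum_mem K_subset_K_perp[OF assms(1)]) auto
  then have "L (?s + k) = L ?s"
    using assms(5)[OF k] by simp
  with w sum[of "{..<n}" "\<lambda>i. g p w (e i)"] show ?thesis by simp
qed

text \<open>Expand the second slot in \<open>f\<close>, exchange the sums, and recollect the first
  slot in \<open>e\<close>: by symmetry of \<open>g\<close> both expansions have the same
  coefficients.\<close>

lemma trace_frame_independent:
  fixes B :: "'a tvec \<Rightarrow> 'a tvec \<Rightarrow> real"
  assumes "p \<in> points" "orthonormal_screen_frame n M g K p e" "orthonormal_screen_frame n M g K p f"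
    and "\<And>w. w \<in> K_perp M g K p \<Longrightarrow> linear_map_on (K_perp M g K p) (\<lambda>v. B v w)"
    and "\<And>v. v \<in> K_perp M g K p \<Longrightarrow> linear_map_on (K_perp M g K p) (\<lambda>w. B v w)"
    and "\<And>k w. k \<in> K p \<Longrightarrow> w \<in> K_perp M g K p \<Longrightarrow> B k w = 0"
    and "\<And>k w. k \<in> K p \<Longrightarrow> w \<in> K_perp M g K p \<Longrightarrow> B w k = 0"
  shows "(\<Sum>i<n. B (e i) (e i)) = (\<Sum>i<n. B (f i) (f i))"
proof -
  note e = orthonormal_screen_frame_mem[OF assms(2)]
  note f = orthonormal_screen_frame_mem[OF assms(3)]
  have "(\<Sum>i<n. B (e i) (e i)) = (\<Sum>i<n. \<Sum>j<n. g p (e i) (f j) * B (e i) (f j))"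
    using e assms(5,7) by (intro sum.cong linear_form_expand[OF assms(1,3)]) auto
  also have "\<dots> = (\<Sum>j<n. \<Sum>i<n. g p (f j) (e i) * B (e i) (f j))"
    using e f by (subst sum.swap) (intro sum.cong arg_cong2[of _ _ _ _ "(*)"] metric_sym[OF assms(1)] refl,
      auto intro: K_perp_tangent)
  also have "\<dots> = (\<Sum>j<n. B (f j) (f j))"
    using f assms(4,6)
    by (intro sum.cong refl linear_form_expand[OF assms(1,2), of _ "\<lambda>v. B v _", symmetric]) auto
  finally show ?thesis .
qed

text \<open>Guarantees that the frame chosen by \<open>SOME\<close> in \<open>screen_trace\<close>
  is indeed orthonormal. The pseudo-orthonormal basis provided by the signature gives coordinates in
  which the problem becomes Euclidean.\<close>

lemma orthonormal_screen_frame_exists: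
  assumes "p \<in> points"
  shows "\<exists>e. orthonormal_screen_frame n M g K p e"
proof -
  obtain E :: "'d \<Rightarrow> 'a tvec" and i0 where span: "tangent_space M p = span (range E)"
    and E: "\<And>i j. g p (E i) (E j) = (if i \<noteq> j then 0 else if i = i0 then -1 else 1)"
    using lorentzian assms unfolding lorentzian_metric_def by blast
  define L where "L = (\<lambda>x :: real ^ 'd. \<Sum>i\<in>UNIV. x $ i *\<^sub>R E i)"
  interpret L: linear L
    unfolding L_def by (rule linear_combination_linear)
  have L: "L x = (\<Sum>i\<in>UNIV. x $ i *\<^sub>R E i)" for x
    by (simp only: L_def)
  have ET: "E i \<in> tangent_space M p" for i
    unfolding span by (rule span_base) simp
  then have sET: "a *\<^sub>R E i \<in> tangent_space M p" for a i
    using tangent_subspace[OF assms] by (rule subspace_scale[rotated])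
  have LT: "L x \<in> tangent_space M p" for x
    unfolding L_def using tangent_subspace[OF assms] sET by (rule subspace_sum)
  \<comment> \<open>The Minkowski product is the Euclidean one with the time term reversed; they
    agree as soon as one of the vectors has time component 0.\<close>
  have gL: "g p (L x) (L y) = x \<bullet> y - 2 * (x $ i0 * y $ i0)" for x y
  proof -
    have gE: "g p (E i) (L y) = (if i = i0 then - (y $ i0) else y $ i)" for i
    proof -
      have "g p (E i) (L y) = g p (L y) (E i)"
        by (rule metric_sym[OF assms ET LT])
      also have "\<dots> = (\<Sum>j\<in>UNIV. y $ j * g p (E j) (E i))"
        unfolding L_def by (rule metric_combination_left[OF assms ET ET])
      also have "\<dots> = (\<Sum>j\<in>UNIV. if j = i then (if i = i0 then - (y $ i0) else y $ i) else 0)"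
        by (intro sum.cong refl) (simp add: E)
      finally show ?thesis by simp
    qed
    have "g p (L x) (L y) = (\<Sum>i\<in>UNIV. x $ i * g p (E i) (L y))"
      unfolding L[of x] by (rule metric_combination_left[OF assms LT ET])
    also have "\<dots> = (\<Sum>i\<in>UNIV. x $ i * y $ i - (if i = i0 then 2 * (x $ i0 * y $ i0) else 0))"
      by (intro sum.cong refl) (simp add: gE)
    finally show ?thesis by (simp add: sum_subtractf inner_vec_def)
  qed
  have L_surj: "\<exists>x. v = L x" if v: "v \<in> tangent_space M p" for v
  proof -
    from v[unfolded span] obtain c where "v = (\<Sum>i\<in>UNIV. c i *\<^sub>R E i)"
      using span_image_finite[of UNIV v E] by auto
    then show ?thesis by (intro exI[of _ "\<chi> i. c i"]) (simp add: L_def)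
  qed
  obtain \<kappa> where \<kappa>: "\<kappa> \<in> tangent_space M p" "\<kappa> \<noteq> 0" "K p = range (\<lambda>a. a *\<^sub>R \<kappa>)"
    using K_generator[OF assms] .
  then have \<kappa>K: "\<kappa> \<in> K p" by (auto intro: range_eqI[of _ _ 1])
  obtain z where z: "\<kappa> = L z" using L_surj \<kappa>(1) by blast
  \<comment> \<open>Nullity in Euclidean terms: the time component accounts for half of the squared
    norm, so it is nonzero once \<open>z\<close> is.\<close>
  have zz: "z \<bullet> z = 2 * (z $ i0 * z $ i0)"
    using null[OF assms \<kappa>K] gL[of z z] by (simp add: z)
  have "z \<noteq> 0" using \<kappa>(2) L.zero by (auto simp: z)
  then have z0: "z $ i0 \<noteq> 0" using zz by auto
  let ?A = "{axis i0 1, z}"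
  \<comment> \<open>In Minkowski coordinates, the Euclidean complement of the time axis and of \<open>z\<close> is a copy of the
    screen space.\<close>
  define W where "W = {x :: real ^ 'd. \<forall>y\<in>span ?A. orthogonal y x}"
  have W: "x \<in> W \<longleftrightarrow> x $ i0 = 0 \<and> x \<bullet> z = 0" for x
  proof -
    have "x \<in> W \<longleftrightarrow> (\<forall>y\<in>?A. orthogonal x y)"
    proof
      assume "x \<in> W"
      then show "\<forall>y\<in>?A. orthogonal x y"
        unfolding W_def using orthogonal_commute span_base[of _ ?A] by blast
    next
      assume *: "\<forall>y\<in>?A. orthogonal x y"
      then have "orthogonal x y" if "y \<in> span ?A" for y
        using that by (intro orthogonal_to_span[of y ?A x]) blast+
      then show "x \<in> W"
        unfolding W_def using orthogonal_commute by blast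
    qed
    then show ?thesis
      by (simp add: orthogonal_def inner_axis inner_commute)
  qed
  have "independent ?A"
  proof -
    \<comment> \<open>A multiple of the time axis has its entire squared norm in the time component,
      against \<open>zz\<close>.\<close>
    have "z \<noteq> c *\<^sub>R axis i0 1" for c :: real
    proof
      assume eq: "z = c *\<^sub>R axis i0 1"
      then have "z $ i0 = c" "z \<bullet> z = c * c" by (simp_all add: inner_axis_axis)
      with zz z0 show False by simp
    qed
    then have "z \<notin> span {axis i0 1}"
      by (auto simp: span_singleton)
    moreover have "independent {axis i0 1 :: real ^ 'd}" by simp
    ultimately show ?thesis
      by (subst insert_commute) (rule independent_insertI)
  qed
  moreover have "axis i0 1 \<noteq> z"
    using zz by (auto simp: inner_axis_axis)
  ultimately have "dim (span ?A) = 2"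
    by (simp add: dim_eq_card_independent)
  moreover have "dim W + dim (span ?A) = dim (UNIV :: (real ^ 'd) set)"
    using dim_subspace_orthogonal_to_vectors[of "span ?A" UNIV] by (simp add: W_def)
  ultimately have dimW: "dim W = n"
    using dim by simp
  have "subspace W"
    by (auto simp: subspace_def W inner_left_distrib)
  then obtain B where B: "B \<subseteq> W" "pairwise orthogonal B" "\<And>x. x \<in> B \<Longrightarrow> norm x = 1"
    "independent B" "card B = dim W" "span B = W"
    using orthonormal_basis_subspace by blast
  then obtain b where b: "bij_betw b {..<n} B"
    using ex_bij_betw_nat_finite[of B] independent_imp_finite[OF B(4)] dimW by (auto simp: atLeast0LessThan)
  then have bW: "b i \<in> W" if "i < n" for i
    using B(1) that by (auto simp: bij_betw_def)
  define e where "e = (\<lambda>i. L (b i))"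
  have e: "e i \<in> K_perp M g K p" if "i < n" for i
    using bW[OF that] by (auto simp: K_perp_def e_def LT \<kappa>(3) z metric_scale_right[OF assms LT LT] gL W)
  have ge: "g p (e i) (e j) = (if i = j then 1 else 0)" if "i < n" "j < n" for i j
  proof -
    have "b i \<bullet> b j = (if i = j then 1 else 0)"
    proof (cases "i = j")
      case True
      then show ?thesis using B(3)[of "b i"] b that(1) by (auto simp: bij_betw_def norm_eq_1)
    next
      case False
      then have "b i \<noteq> b j" "b i \<in> B" "b j \<in> B"
        using b that by (auto simp: bij_betw_def inj_on_def)
      with B(2) False show ?thesis by (simp add: pairwise_def orthogonal_def)
    qed
    with bW that show ?thesis by (simp add: e_def gL W)
  qed
  have "v \<in> span (e ` {..<n} \<union> K p)" if v: "v \<in> K_perp M g K p" for v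
  proof -
    obtain x where x: "v = L x" using L_surj K_perp_tangent[OF v] by blast
    have xz: "x \<bullet> z = 2 * (x $ i0 * z $ i0)"
      using K_perp_orthogonal(1)[OF assms v \<kappa>K] by (simp add: x z gL)
    \<comment> \<open>Subtracting this multiple of \<open>z\<close> removes the time component of
      \<open>x\<close>; by \<open>xz\<close> and \<open>zz\<close> the difference is then orthogonal
      to \<open>z\<close> as well.\<close>
    define t where "t = x $ i0 / z $ i0"
    have "x - t *\<^sub>R z \<in> W"
      using z0 by (simp add: W t_def inner_diff_left xz zz)
    then have "L (x - t *\<^sub>R z) \<in> span (L ` B)"
      using B(6) linear_span_image[OF L.linear_axioms] by blast
    moreover have "L ` B = e ` {..<n}"
      using b by (auto simp: bij_betw_def e_def)
    ultimately have "L (x - t *\<^sub>R z) + t *\<^sub>R \<kappa> \<in> span (e ` {..<n} \<union> K p)"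
      using \<kappa>K by (intro span_add span_scale) (auto intro: span_base span_mono[THEN subsetD, rotated])
    then show ?thesis by (simp add: x z L.diff L.scale)
  qed
  moreover have "span (e ` {..<n} \<union> K p) \<subseteq> K_perp M g K p"
    using e K_subset_K_perp[OF assms] K_perp_subspace[OF assms] by (intro span_minimal) auto
  ultimately have "orthonormal_screen_frame n M g K p e"
    using screen_metric_coset[OF assms] e ge unfolding orthonormal_screen_frame_def by auto
  then show ?thesis by (rule exI[of _ e])
qed

text \<open>Ensures that the extension chosen in \<open>intrinsic_torsion\<close> is a smooth
  section of \<open>K\<close>; a constant multiple of a local generator serves.\<close>

lemma section_extension:
  assumes "p \<in> points" "k \<in> K p"
  shows "\<exists>\<kappa>. \<kappa> p = k \<and> (\<exists>U. p \<in> U \<and> smooth_section M K U \<kappa>)"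
proof -
  have "\<exists>U \<kappa>. p \<in> U \<and> smooth_vfield M U \<kappa> \<and> (\<forall>q\<in>U. \<kappa> q \<noteq> 0 \<and> K q = span {\<kappa> q})"
    using assms(1) line[unfolded line_distribution_def] by (rule bspec[rotated])
  then obtain U \<kappa> where U: "p \<in> U" "smooth_vfield M U \<kappa>" and \<kappa>: "\<And>q. q \<in> U \<Longrightarrow> K q = span {\<kappa> q}"
    by (elim exE conjE) simp
  obtain a where a: "k = a *\<^sub>R \<kappa> p"
    using assms(2) \<kappa>[OF U(1)] by (auto simp: span_singleton)
  have "smooth_vfield M U (\<lambda>q. a *\<^sub>R \<kappa> q)"
    using manifold U(2) tangent_subspace[OF smooth_vfield_points[OF U(2)]] by (rule smooth_vfield_scale)
  moreover have "a *\<^sub>R \<kappa> q \<in> K q" if "q \<in> U" for q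
    unfolding \<kappa>[OF that] by (intro span_scale span_base) simp
  ultimately have "smooth_section M K U (\<lambda>q. a *\<^sub>R \<kappa> q)"
    by (simp add: smooth_section_def)
  with U(1) a show ?thesis
    by (intro exI[of _ "\<lambda>q. a *\<^sub>R \<kappa> q"] conjI exI[of _ U]) auto
qed

text \<open>Returns the very representative picked by \<open>SOME\<close>, so that
  \<open>screen_part\<close> and \<open>screen_metric\<close> unfold to it directly.\<close>

lemma screen_representative:
  assumes "p \<in> points" "V \<in> screen_space M g K p"
  obtains v where "v \<in> K_perp M g K p" "V = v +o K p" "(SOME x. x \<in> V) = v"
proof -
  obtain v where v: "v \<in> K_perp M g K p" "V = v +o K p"
    using assms(2) by (auto simp: screen_space_def)
  obtain k where k: "k \<in> K p" "(SOME x. x \<in> v +o K p) = v + k"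
    using coset_some[OF assms(1)] .
  show ?thesis
  proof (rule that)
    show "v + k \<in> K_perp M g K p"
      using v(1) K_subset_K_perp[OF assms(1) k(1)] by (rule subspace_add[OF K_perp_subspace[OF assms(1)]])
    show "V = (v + k) +o K p"
      unfolding coset_absorb[OF assms(1) k(1)] by (rule v(2))
    show "(SOME x. x \<in> V) = v + k"
      unfolding v(2) by (rule k(2))
  qed
qed

lemma screen_metric_sym:
  assumes "p \<in> points" "V \<in> screen_space M g K p" "W \<in> screen_space M g K p"
  shows "screen_metric g p V W = screen_metric g p W V"
proof -
  obtain v where v: "v \<in> K_perp M g K p" "V = v +o K p"
    using screen_representative[OF assms(1,2)] .
  obtain w where w: "w \<in> K_perp M g K p" "W = w +o K p"
    using screen_representative[OF assms(1,3)] .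
  show ?thesis
    using v w metric_sym[OF assms(1) K_perp_tangent K_perp_tangent, of v w]
    by (simp add: screen_metric_coset[OF assms(1)])
qed

text \<open>With \<open>n = 0\<close> the quotient by \<open>real n\<close> in
  \<open>tracefree_sym_part\<close> is 0, so no trace is removed and the pure-trace correction has
  to vanish by itself. It does, as \<open>K_perp\<close> then equals \<open>K\<close>.\<close>

lemma screen_metric_zero_dim:
  assumes "p \<in> points" "V \<in> screen_space M g K p" "W \<in> screen_space M g K p" "n = 0"
  shows "screen_metric g p V W = 0"
proof -
  obtain e where "orthonormal_screen_frame n M g K p e"
    using orthonormal_screen_frame_exists[OF assms(1)] by blast
  then have "K_perp M g K p = K p"
    using assms(4) K_subspace[OF assms(1)] by (simp add: orthonormal_screen_frame_def span_eq_iff[THEN iffD2])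
  then show ?thesis
    using assms(2,3) K_null[OF assms(1)] K_subset_K_perp[OF assms(1)]
    by (auto simp: screen_space_def screen_metric_coset[OF assms(1)])
qed

text \<open>\<open>screen_trace\<close> evaluates at an unspecified frame and at unspecified representatives of cosets.\<close>

lemma screen_trace_eq:
  assumes "p \<in> points" "t \<in> G_minus1 M g K p" "k \<in> K p" "orthonormal_screen_frame n M g K p e"
  shows "screen_trace n M g K p (screen_part t) k = (\<Sum>i<n. t (e i) (e i +o K p) k)"
proof -
  have t: "t \<in> G_fibre M g K p"
    and t0: "\<And>v W. v \<in> K p \<Longrightarrow> W \<in> screen_space M g K p \<Longrightarrow> t v W k = 0"
    using assms(2,3) by (auto simp: G_minus1_def)
  have lin1: "linear_map_on (K_perp M g K p) (\<lambda>v. t v (w +o K p) k)" if "w \<in> K_perp M g K p" for w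
  proof -
    have "linear_map_on (tangent_space M p) (\<lambda>v. t v (w +o K p) k)"
      using t that assms(3) by (auto simp: G_fibre_def screen_space_def)
    then show ?thesis by (auto simp: linear_map_on_def K_perp_tangent)
  qed
  have lin2: "linear_map_on (K_perp M g K p) (\<lambda>w. t v (w +o K p) k)" if "v \<in> K_perp M g K p" for v
    using t that assms(3) by (auto simp: G_fibre_def K_perp_tangent)
  have van1: "t l (w +o K p) k = 0" if "l \<in> K p" "w \<in> K_perp M g K p" for l w
    using t0[OF that(1)] that(2) by (auto simp: screen_space_def)
  have van2: "t w (l +o K p) k = 0" if "l \<in> K p" "w \<in> K_perp M g K p" for l w
  proof -
    have "0 \<in> K_perp M g K p" by (rule subspace_0[OF K_perp_subspace[OF assms(1)]])
    \<comment> \<open>The all-zero combination gives the value 0 at the coset of 0, which is also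
      the coset of \<open>l\<close>.\<close>
    then have "t w ((0 *\<^sub>R 0 + 0 *\<^sub>R 0) +o K p) k = 0"
      using lin2[OF that(2), unfolded linear_map_on_def, rule_format, of 0 0 0 0] by simp
    then have "t w ((0 + l) +o K p) k = 0"
      unfolding coset_absorb[OF assms(1) that(1)] by simp
    then show ?thesis by simp
  qed
  define f where "f = (SOME f. orthonormal_screen_frame n M g K p f)"
  have f: "orthonormal_screen_frame n M g K p f"
    unfolding f_def using assms(4) by (rule someI[of "orthonormal_screen_frame n M g K p"])
  have "screen_part t (f i +o K p) (f i +o K p) k = t (f i) (f i +o K p) k" if "i < n" for i
  proof -
    note mem = orthonormal_screen_frame_mem[OF f that]
    obtain l where l: "l \<in> K p" "(SOME x. x \<in> f i +o K p) = f i + l"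
      using coset_some[OF assms(1)] .
    have "t (1 *\<^sub>R f i + 1 *\<^sub>R l) (f i +o K p) k = 1 *\<^sub>R t (f i) (f i +o K p) k + 1 *\<^sub>R t l (f i +o K p) k"
      using lin1[OF mem] mem K_subset_K_perp[OF assms(1) l(1)] unfolding linear_map_on_def by blast
    then show ?thesis
      by (simp add: screen_part_def l van1[OF l(1) mem])
  qed
  then have "screen_trace n M g K p (screen_part t) k = (\<Sum>i<n. t (f i) (f i +o K p) k)"
    unfolding screen_trace_def Let_def f_def[symmetric] by (intro sum.cong) auto
  also have "\<dots> = (\<Sum>i<n. t (e i) (e i +o K p) k)"
    using f assms(4) lin1 lin2 van1 van2
    by (intro trace_frame_independent[OF assms(1), of f e "\<lambda>v w. t v (w +o K p) k"])
  finally show ?thesis .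
qed

end

section \<open>Conformal change of the intrinsic torsion\<close>

locale conformal_change = optical_geometry n M K g
  for n and M :: "('a, 'd::finite) charted_space" and K and g :: "'a metric_field" +
  fixes ghat :: "'a metric_field" and nabla nablahat :: "'a conn" and \<phi> :: "'a \<Rightarrow> real"
  assumes lorentzian_hat: "lorentzian_metric M ghat"
    and levi_civita: "levi_civita M g nabla"
    and levi_civita_hat: "levi_civita M ghat nablahat"
    and smooth_factor: "smooth_fun M points \<phi>"
    and conformal: "\<And>p v w. p \<in> points \<Longrightarrow> v \<in> tangent_space M p \<Longrightarrow> w \<in> tangent_space M p \<Longrightarrow>
      ghat p v w = exp (2 * \<phi> p) * g p v w"
begin

text \<open>Makes frames and traces available for the second metric; its values on \<open>K\<close>
  vanish along with those of \<open>g\<close>.\<close>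

sublocale hat: optical_geometry n M K ghat
  by unfold_locales (use manifold dim lorentzian_hat line in \<open>auto simp: conformal K_tangent K_null\<close>)

lemma K_perp_hat: "p \<in> points \<Longrightarrow> K_perp M ghat K p = K_perp M g K p"
  by (auto simp: K_perp_def conformal K_tangent)

lemma screen_space_hat: "p \<in> points \<Longrightarrow> screen_space M ghat K p = screen_space M g K p"
  by (simp add: screen_space_def K_perp_hat)

section \<open>The difference of the two connections\<close>

lemma nabla_tangent:
  assumes "smooth_vfield M U Y" "p \<in> U" "v \<in> tangent_space M p"
  shows "nabla p v Y \<in> tangent_space M p" "nablahat p v Y \<in> tangent_space M p"
  using levi_civita levi_civita_hat affine_connection_tangent[OF _ assms]
  by (auto simp: levi_civita_def)

text \<open>The derivative of \<open>ghat\<close> on \<open>Y\<close> and \<open>Z\<close> is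
  computed with either connection and the conformal factor cancelled. Only \<open>g\<close> remains,
  so both connections are measured by one metric.\<close>

lemma metric_compatibility_hat:
  assumes Y: "smooth_vfield M U Y" and Z: "smooth_vfield M U Z" and p: "p \<in> U"
    and v: "v \<in> tangent_space M p"
  shows "g p (nablahat p v Y) (Z p) + g p (nablahat p v Z) (Y p) =
    g p (nabla p v Y) (Z p) + g p (nabla p v Z) (Y p) + 2 * v \<phi> * g p (Y p) (Z p)"
proof -
  note P = smooth_vfield_points[OF Y]
  note T = smooth_vfield_tangent[OF Y] smooth_vfield_tangent[OF Z]
  have U: "openin (space_top M) U" using Y by (simp add: smooth_vfield_def)
  have \<phi>: "smooth_fun M U \<phi>"
    using smooth_factor P U by (auto intro: smooth_fun_subset)
  have gYZ: "smooth_fun M U (\<lambda>q. g q (Y q) (Z q))"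
    using lorentzian Y Z by (simp add: lorentzian_metric_def)
  let ?e = "exp (2 * \<phi> p)"
  have "ghat p (nablahat p v Y) (Z p) + ghat p (Y p) (nablahat p v Z) = v (\<lambda>q. ghat q (Y q) (Z q))"
    using levi_civita_metric[OF levi_civita_hat Y Z p v] ..
  \<comment> \<open>The two functions are known to agree on \<open>U\<close> only; locality of
    \<open>v\<close> suffices.\<close>
  also have "\<dots> = v (\<lambda>q. exp (2 * \<phi> q) * g q (Y q) (Z q))"
    by (rule tangent_cong[OF manifold v U p]) (simp add: conformal P T)
  also have "\<dots> = ?e * v (\<lambda>q. g q (Y q) (Z q)) + v (\<lambda>q. exp (2 * \<phi> q)) * g p (Y p) (Z p)"
    by (rule tangent_mult[OF manifold v p smooth_fun_exp[OF manifold smooth_fun_cmult[OF manifold \<phi>]] gYZ])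
  also have "v (\<lambda>q. exp (2 * \<phi> q)) = 2 * ?e * v \<phi>"
    by (rule tangent_exp[OF manifold v p \<phi>])
  also have "v (\<lambda>q. g q (Y q) (Z q)) = g p (nabla p v Y) (Z p) + g p (Y p) (nabla p v Z)"
    by (rule levi_civita_metric[OF levi_civita Y Z p v])
  finally have "?e * (g p (nablahat p v Y) (Z p) + g p (Y p) (nablahat p v Z)) =
      ?e * (g p (nabla p v Y) (Z p) + g p (Y p) (nabla p v Z) + 2 * v \<phi> * g p (Y p) (Z p))"
    using P[OF p] T[OF p] nabla_tangent[OF Y p v] nabla_tangent[OF Z p v]
    by (simp add: conformal algebra_simps)
  then show ?thesis
    using metric_sym[OF P[OF p] T(1)[OF p]] nabla_tangent[OF Z p v] by simp
qed

text \<open>Both connections are torsion-free, so their antisymmetrizations are the same Lie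
  bracket. Pairing with \<open>z\<close> turns this into the scalar equations that
  \<open>connection_difference\<close> solves.\<close>

lemma connection_difference_sym:
  assumes X: "smooth_vfield M U X" and Y: "smooth_vfield M U Y" and p: "p \<in> U"
    and z: "z \<in> tangent_space M p"
  shows "g p (nablahat p (X p) Y) z - g p (nabla p (X p) Y) z =
    g p (nablahat p (Y p) X) z - g p (nabla p (Y p) X) z"
proof -
  note P = smooth_vfield_points[OF X p]
  note T = smooth_vfield_tangent[OF X p] smooth_vfield_tangent[OF Y p]
  note D = metric_diff_left[OF P z]
  have "nablahat p (X p) Y - nablahat p (Y p) X = nabla p (X p) Y - nabla p (Y p) X"
    using levi_civita_torsion_free[OF levi_civita X Y p] levi_civita_torsion_free[OF levi_civita_hat X Y p]
    by simp
  then show ?thesis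
    using D[OF nabla_tangent(1)[OF Y p T(1)] nabla_tangent(1)[OF X p T(2)]]
      D[OF nabla_tangent(2)[OF Y p T(1)] nabla_tangent(2)[OF X p T(2)]] by simp
qed

lemma connection_difference:
  assumes X: "smooth_vfield M U X" and Y: "smooth_vfield M U Y" and Z: "smooth_vfield M U Z"
    and p: "p \<in> U"
  shows "g p (nablahat p (X p) Y) (Z p) = g p (nabla p (X p) Y) (Z p) +
    X p \<phi> * g p (Y p) (Z p) + Y p \<phi> * g p (X p) (Z p) - Z p \<phi> * g p (X p) (Y p)"
proof -
  note P = smooth_vfield_points[OF X p]
  note x = smooth_vfield_tangent[OF X p]
  note y = smooth_vfield_tangent[OF Y p]
  note z = smooth_vfield_tangent[OF Z p]
  \<comment> \<open>Koszul's argument: the three cyclic compatibility identities, solved using symmetry.\<close>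
  show ?thesis
    using metric_compatibility_hat[OF Y Z p x] metric_compatibility_hat[OF X Z p y]
      metric_compatibility_hat[OF X Y p z] connection_difference_sym[OF X Y p z]
      connection_difference_sym[OF X Z p y] connection_difference_sym[OF Y Z p x]
      metric_sym[OF P x y] metric_sym[OF P x z] metric_sym[OF P y z]
    by (simp add: algebra_simps)
qed

section \<open>The transformation law of the torsion\<close>

abbreviation torsion :: "'a \<Rightarrow> 'a torsion_form" where
  "torsion \<equiv> intrinsic_torsion M g nabla K"

abbreviation torsion_hat :: "'a \<Rightarrow> 'a torsion_form" where
  "torsion_hat \<equiv> intrinsic_torsion M ghat nablahat K"

text \<open>Neither choice in \<open>intrinsic_torsion\<close> mentions the metric, so the same
  \<open>\<kappa>\<close> and \<open>z\<close> serve both torsions and the connection difference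
  applies to them. Its term with \<open>v \<phi>\<close> drops out since \<open>k\<close> is
  orthogonal to \<open>z\<close>.\<close>

lemma torsion_hat_eq:
  assumes p: "p \<in> points" and v: "v \<in> tangent_space M p" and w: "w \<in> K_perp M g K p" and k: "k \<in> K p"
  shows "torsion_hat p v (w +o K p) k = exp (2 * \<phi> p) *
    (torsion p v (w +o K p) k + (k \<phi> * g p v w - g p v k * w \<phi>))"
proof -
  define \<kappa> where "\<kappa> = (SOME \<kappa>. \<kappa> p = k \<and> (\<exists>U. p \<in> U \<and> smooth_section M K U \<kappa>))"
  obtain U where \<kappa>p: "\<kappa> p = k" and "p \<in> U" and U: "smooth_vfield M U \<kappa>"
    using someI_ex[OF section_extension[OF p k], folded \<kappa>_def] by (auto simp: smooth_section_def)
  obtain l where l: "l \<in> K p" and some: "(SOME x. x \<in> w +o K p) = w + l"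
    using coset_some[OF p] .
  define z where "z = w + l"
  have zT: "z \<in> tangent_space M p"
    unfolding z_def using K_perp_tangent[OF w] K_tangent[OF p l]
    by (rule subspace_add[OF tangent_subspace[OF p]])
  obtain V X where V: "p \<in> V" "smooth_vfield M V X" "X p = v"
    using tangent_extension[OF manifold v] .
  obtain V' Z where V': "p \<in> V'" "smooth_vfield M V' Z" "Z p = z"
    using tangent_extension[OF manifold zT] .
  \<comment> \<open>\<open>connection_difference\<close> wants its three fields on one open
    set.\<close>
  define W where "W = U \<inter> V \<inter> V'"
  have oW: "openin (space_top M) W"
    using U V(2) V'(2) by (auto simp: W_def smooth_vfield_def)
  have W: "smooth_vfield M W X" "smooth_vfield M W \<kappa>" "smooth_vfield M W Z" "p \<in> W"
    using smooth_vfield_subset[OF U _ oW] smooth_vfield_subset[OF V(2) _ oW]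
      smooth_vfield_subset[OF V'(2) _ oW] \<open>p \<in> U\<close> V(1) V'(1) by (auto simp: W_def)
  have kz: "g p k z = 0"
    unfolding z_def metric_add_right[OF p K_tangent[OF p k] K_perp_tangent[OF w] K_tangent[OF p l]]
    using K_perp_orthogonal(2)[OF p w k] K_null[OF p k l] by simp
  have D: "g p (nablahat p v \<kappa>) z = g p (nabla p v \<kappa>) z + (k \<phi> * g p v z - z \<phi> * g p v k)"
    using connection_difference[OF W] kz V(3) V'(3) \<kappa>p by simp
  obtain \<kappa>0 where \<kappa>0: "\<kappa>0 \<in> tangent_space M p" "K p = range (\<lambda>a. a *\<^sub>R \<kappa>0)"
    using K_generator[OF p] .
  obtain a b where ab: "k = a *\<^sub>R \<kappa>0" "l = b *\<^sub>R \<kappa>0"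
    using k l \<kappa>0(2) by auto
  \<comment> \<open>The correction term does not see the choice of representative of \<open>w + K\<close>, as \<open>K\<close> is a line.\<close>
  have "k \<phi> * g p v l = l \<phi> * g p v k"
    unfolding ab by (simp add: metric_scale_right[OF p v \<kappa>0(1)] scaleR_fun_apply)
  then have E: "k \<phi> * g p v z - z \<phi> * g p v k = k \<phi> * g p v w - g p v k * w \<phi>"
    unfolding z_def metric_add_right[OF p v K_perp_tangent[OF w] K_tangent[OF p l]] plus_fun_apply
    by (simp add: algebra_simps)
  have "torsion_hat p v (w +o K p) k = exp (2 * \<phi> p) * g p (nablahat p v \<kappa>) z"
    unfolding intrinsic_torsion_def some \<kappa>_def[symmetric] z_def[symmetric]
    using nabla_tangent(2)[OF U \<open>p \<in> U\<close> v] zT by (rule conformal[OF p])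
  moreover have "torsion p v (w +o K p) k = g p (nabla p v \<kappa>) z"
    unfolding intrinsic_torsion_def some \<kappa>_def[symmetric] z_def[symmetric] ..
  ultimately show ?thesis
    using D E by simp
qed

text \<open>The correction is linear in each slot separately: through \<open>g\<close> in
  \<open>v\<close>, and through both \<open>g\<close> and the action on \<open>\<phi>\<close> in
  \<open>w\<close> and \<open>k\<close>.\<close>

lemma G_fibre_hat:
  assumes p: "p \<in> points" and T: "torsion p \<in> G_fibre M g K p"
  shows "torsion_hat p \<in> G_fibre M ghat K p"
  unfolding G_fibre_def
proof (intro CollectI conjI ballI)
  fix W k assume "W \<in> screen_space M ghat K p" and k: "k \<in> K p"
  then have W: "W \<in> screen_space M g K p" by (simp add: screen_space_hat[OF p])
  then obtain w where w: "w \<in> K_perp M g K p" "W = w +o K p"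
    by (auto simp: screen_space_def)
  have "linear_map_on (tangent_space M p) (\<lambda>v. torsion p v W k)"
    using T W k by (auto simp: G_fibre_def)
  moreover have "linear_map_on (tangent_space M p) (\<lambda>v. k \<phi> * g p v w - g p v k * w \<phi>)"
    using metric_lin_left[OF p K_perp_tangent[OF w(1)]] metric_lin_left[OF p K_tangent[OF p k]]
    by (simp add: linear_map_on_def algebra_simps)
  ultimately show "linear_map_on (tangent_space M p) (\<lambda>v. torsion_hat p v W k)"
    unfolding w(2)
    by (rule linear_map_on_affine_comb[OF tangent_subspace[OF p]]) (rule torsion_hat_eq[OF p _ w(1) k])
next
  fix v k assume v: "v \<in> tangent_space M p" and k: "k \<in> K p"
  have "linear_map_on (K_perp M g K p) (\<lambda>w. torsion p v (w +o K p) k)"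
    using T v k by (auto simp: G_fibre_def)
  moreover have "linear_map_on (K_perp M g K p) (\<lambda>w. k \<phi> * g p v w - g p v k * w \<phi>)"
    using metric_lin_right[OF p v K_perp_tangent K_perp_tangent]
    by (simp add: linear_map_on_def scaleR_fun_apply algebra_simps)
  ultimately show "linear_map_on (K_perp M ghat K p) (\<lambda>w. torsion_hat p v (w +o K p) k)"
    unfolding K_perp_hat[OF p]
    by (rule linear_map_on_affine_comb[OF K_perp_subspace[OF p]]) (rule torsion_hat_eq[OF p v _ k])
next
  fix v W assume v: "v \<in> tangent_space M p" and "W \<in> screen_space M ghat K p"
  then have W: "W \<in> screen_space M g K p" by (simp add: screen_space_hat[OF p])
  then obtain w where w: "w \<in> K_perp M g K p" "W = w +o K p"
    by (auto simp: screen_space_def)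
  have "linear_map_on (K p) (\<lambda>k. torsion p v W k)"
    using T v W by (auto simp: G_fibre_def)
  moreover have "linear_map_on (K p) (\<lambda>k. k \<phi> * g p v w - g p v k * w \<phi>)"
    using metric_lin_right[OF p v K_tangent[OF p] K_tangent[OF p]]
    by (simp add: linear_map_on_def scaleR_fun_apply algebra_simps)
  ultimately show "linear_map_on (K p) (\<lambda>k. torsion_hat p v W k)"
    unfolding w(2)
    by (rule linear_map_on_affine_comb[OF K_subspace[OF p]]) (rule torsion_hat_eq[OF p v w(1)])
qed

lemma G_minus1_hat:
  assumes p: "p \<in> points" and T: "torsion p \<in> G_minus1 M g K p"
  shows "torsion_hat p \<in> G_minus1 M ghat K p"
proof -
  have "torsion_hat p v W k = 0" if v: "v \<in> K p" and W: "W \<in> screen_space M g K p" and k: "k \<in> K p" for v W k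
  proof -
    obtain w where w: "w \<in> K_perp M g K p" "W = w +o K p"
      using W by (auto simp: screen_space_def)
    have "torsion p v (w +o K p) k = 0"
      using T v W k w(2) by (auto simp: G_minus1_def)
    then show ?thesis
      by (simp add: w(2) torsion_hat_eq[OF p K_tangent[OF p v] w(1) k] K_null[OF p v k]
          K_perp_orthogonal(2)[OF p w(1) v])
  qed
  moreover have "torsion_hat p \<in> G_fibre M ghat K p"
    using T by (intro G_fibre_hat p) (simp add: G_minus1_def)
  ultimately show ?thesis
    by (simp add: G_minus1_def screen_space_hat[OF p])
qed

section \<open>Skew part, symmetric part and trace under the change of metric\<close>

lemma screen_part_hat:
  assumes p: "p \<in> points" and V: "V \<in> screen_space M g K p" and W: "W \<in> screen_space M g K p"
    and k: "k \<in> K p"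
  shows "screen_part (torsion_hat p) V W k =
    exp (2 * \<phi> p) * (screen_part (torsion p) V W k + k \<phi> * screen_metric g p V W)"
proof -
  obtain v where v: "v \<in> K_perp M g K p" "V = v +o K p" "(SOME x. x \<in> V) = v"
    using screen_representative[OF p V] .
  obtain w where w: "w \<in> K_perp M g K p" "W = w +o K p" "(SOME x. x \<in> W) = w"
    using screen_representative[OF p W] .
  have "screen_metric g p V W = g p v w"
    by (simp add: screen_metric_def v(3) w(3))
  then show ?thesis
    using torsion_hat_eq[OF p K_perp_tangent[OF v(1)] w(1) k] K_perp_orthogonal(1)[OF p v(1) k]
    by (simp add: screen_part_def v(3) w(2))
qed

lemma screen_metric_hat:
  assumes p: "p \<in> points" and V: "V \<in> screen_space M g K p" and W: "W \<in> screen_space M g K p"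
  shows "screen_metric ghat p V W = exp (2 * \<phi> p) * screen_metric g p V W"
proof -
  obtain v where v: "v \<in> K_perp M g K p" "(SOME x. x \<in> V) = v"
    using screen_representative[OF p V] .
  obtain w where w: "w \<in> K_perp M g K p" "(SOME x. x \<in> W) = w"
    using screen_representative[OF p W] .
  show ?thesis
    unfolding screen_metric_def v(2) w(2)
    by (rule conformal[OF p K_perp_tangent[OF v(1)] K_perp_tangent[OF w(1)]])
qed

lemma skew_part_hat:
  assumes "p \<in> points" "V \<in> screen_space M g K p" "W \<in> screen_space M g K p" "k \<in> K p"
  shows "skew_part (screen_part (torsion_hat p)) V W k =
    exp (2 * \<phi> p) * skew_part (screen_part (torsion p)) V W k"
  unfolding skew_part_def screen_part_hat[OF assms] screen_part_hat[OF assms(1,3,2,4)]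
    screen_metric_sym[OF assms(1,3,2)]
  by (simp add: algebra_simps)

lemma sym_part_hat:
  assumes "p \<in> points" "V \<in> screen_space M g K p" "W \<in> screen_space M g K p" "k \<in> K p"
  shows "sym_part (screen_part (torsion_hat p)) V W k =
    exp (2 * \<phi> p) * (sym_part (screen_part (torsion p)) V W k + k \<phi> * screen_metric g p V W)"
  unfolding sym_part_def screen_part_hat[OF assms] screen_part_hat[OF assms(1,3,2,4)]
    screen_metric_sym[OF assms(1,3,2)]
  by (simp add: field_simps)

text \<open>\<open>ghat\<close> multiplies squared lengths by \<open>exp (2 * \<phi> p)\<close>,
  which two factors \<open>exp (- \<phi> p)\<close> compensate.\<close>

lemma orthonormal_screen_frame_hat:
  assumes p: "p \<in> points" and e: "orthonormal_screen_frame n M g K p e"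
  shows "orthonormal_screen_frame n M ghat K p (\<lambda>i. exp (- \<phi> p) *\<^sub>R e i)"
proof -
  let ?f = "\<lambda>i. exp (- \<phi> p) *\<^sub>R e i"
  note mem = orthonormal_screen_frame_mem[OF e]
  have f: "?f i \<in> K_perp M g K p" if "i < n" for i
    using mem[OF that] by (rule subspace_scale[OF K_perp_subspace[OF p]])
  have "?f ` {..<n} \<union> K p \<subseteq> span (e ` {..<n} \<union> K p)"
    by (auto intro!: span_scale intro: span_base)
  moreover have "e i \<in> span (?f ` {..<n} \<union> K p)" if "i < n" for i
  proof -
    have "exp (\<phi> p) *\<^sub>R ?f i \<in> span (?f ` {..<n} \<union> K p)"
      using that by (intro span_scale span_base) auto
    then show ?thesis by (simp add: exp_minus)
  qed
  then have "e ` {..<n} \<union> K p \<subseteq> span (?f ` {..<n} \<union> K p)"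
    by (auto intro: span_base)
  ultimately have "span (?f ` {..<n} \<union> K p) = span (e ` {..<n} \<union> K p)"
    by (intro subset_antisym span_minimal subspace_span)
  moreover have "screen_metric ghat p (?f i +o K p) (?f j +o K p) = (if i = j then 1 else 0)"
    if "i < n" "j < n" for i j
  proof -
    have "screen_metric ghat p (?f i +o K p) (?f j +o K p) = ghat p (?f i) (?f j)"
      using f that by (intro hat.screen_metric_coset[OF p]) (simp_all add: K_perp_hat[OF p])
    also have "\<dots> = exp (2 * \<phi> p) * g p (?f i) (?f j)"
      by (rule conformal[OF p K_perp_tangent K_perp_tangent]) (intro f that)+
    also have "\<dots> = exp (2 * \<phi> p) * (exp (- \<phi> p) * (exp (- \<phi> p) * g p (e i) (e j)))"
      by (subst metric_scale_left[OF p K_perp_tangent K_perp_tangent], (intro f mem that)+,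
          subst metric_scale_right[OF p K_perp_tangent K_perp_tangent], (intro mem that)+, rule refl)
    also have "\<dots> = g p (e i) (e j)"
      by (simp flip: mult.assoc exp_add)
    finally show ?thesis
      using orthonormal_screen_frame_metric[OF p e that] by simp
  qed
  ultimately show ?thesis
    using e by (simp add: orthonormal_screen_frame_def K_perp_hat[OF p])
qed

text \<open>The trace carries no exponential: the factor in \<open>torsion_hat\<close> cancels the
  square of the scaling \<open>s\<close> of the frame. Each of the \<open>n\<close> frame vectors
  contributes one \<open>k \<phi>\<close>.\<close>

lemma screen_trace_hat:
  assumes p: "p \<in> points" and T: "torsion p \<in> G_minus1 M g K p" and k: "k \<in> K p"
  shows "screen_trace n M ghat K p (screen_part (torsion_hat p)) k =
    screen_trace n M g K p (screen_part (torsion p)) k + real n * k \<phi>"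
proof -
  obtain e where e: "orthonormal_screen_frame n M g K p e"
    using orthonormal_screen_frame_exists[OF p] by blast
  define s where "s = exp (- \<phi> p)"
  have s: "exp (2 * \<phi> p) * (s * s) = 1"
    by (simp add: s_def flip: exp_add)
  have summand: "torsion_hat p (s *\<^sub>R e i) ((s *\<^sub>R e i) +o K p) k =
      torsion p (e i) (e i +o K p) k + k \<phi>" if "i < n" for i
  proof -
    note mem = orthonormal_screen_frame_mem[OF e that]
    have f: "s *\<^sub>R e i \<in> K_perp M g K p"
      using mem by (rule subspace_scale[OF K_perp_subspace[OF p]])
    have lin: "linear_map_on (tangent_space M p) (\<lambda>v. torsion p v ((s *\<^sub>R e i) +o K p) k)"
       "linear_map_on (K_perp M g K p) (\<lambda>w. torsion p (e i) (w +o K p) k)"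
      using T f k K_perp_tangent[OF mem] by (auto simp: G_minus1_def G_fibre_def screen_space_def)
    \<comment> \<open>The terms with coefficient 0 bring the scaling of each slot into the two-term
      form of \<open>linear_map_on\<close>.\<close>
    have "torsion p (s *\<^sub>R e i + 0 *\<^sub>R e i) ((s *\<^sub>R e i) +o K p) k =
        s *\<^sub>R torsion p (e i) ((s *\<^sub>R e i) +o K p) k + 0 *\<^sub>R torsion p (e i) ((s *\<^sub>R e i) +o K p) k"
      using lin(1) K_perp_tangent[OF mem] unfolding linear_map_on_def by blast
    moreover have "torsion p (e i) ((s *\<^sub>R e i + 0 *\<^sub>R e i) +o K p) k =
        s *\<^sub>R torsion p (e i) (e i +o K p) k + 0 *\<^sub>R torsion p (e i) (e i +o K p) k"
      using lin(2) mem unfolding linear_map_on_def by blast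
    ultimately have "torsion p (s *\<^sub>R e i) ((s *\<^sub>R e i) +o K p) k = s * s * torsion p (e i) (e i +o K p) k"
      by simp
    moreover have "g p (s *\<^sub>R e i) (s *\<^sub>R e i) = s * s"
      using orthonormal_screen_frame_metric[OF p e that that]
      by (simp add: metric_scale_left[OF p K_perp_tangent[OF f] K_perp_tangent[OF mem]]
          metric_scale_right[OF p K_perp_tangent[OF mem] K_perp_tangent[OF mem]])
    moreover have "torsion_hat p (s *\<^sub>R e i) ((s *\<^sub>R e i) +o K p) k = exp (2 * \<phi> p) *
        (torsion p (s *\<^sub>R e i) ((s *\<^sub>R e i) +o K p) k + k \<phi> * g p (s *\<^sub>R e i) (s *\<^sub>R e i))"
      using torsion_hat_eq[OF p K_perp_tangent[OF f] f k] K_perp_orthogonal(1)[OF p f k] by simp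
    ultimately have "torsion_hat p (s *\<^sub>R e i) ((s *\<^sub>R e i) +o K p) k =
        (exp (2 * \<phi> p) * (s * s)) * (torsion p (e i) (e i +o K p) k + k \<phi>)"
      by (simp add: algebra_simps)
    then show ?thesis by (simp add: s)
  qed
  have "screen_trace n M ghat K p (screen_part (torsion_hat p)) k =
      (\<Sum>i<n. torsion_hat p (s *\<^sub>R e i) ((s *\<^sub>R e i) +o K p) k)"
    unfolding s_def
    by (rule hat.screen_trace_eq[OF p G_minus1_hat[OF p T] k orthonormal_screen_frame_hat[OF p e]])
  also have "\<dots> = (\<Sum>i<n. torsion p (e i) (e i +o K p) k + k \<phi>)"
    using summand by (intro sum.cong) auto
  also have "\<dots> = screen_trace n M g K p (screen_part (torsion p)) k + real n * k \<phi>"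
    by (simp add: sum.distrib screen_trace_eq[OF p T k e])
  finally show ?thesis .
qed

text \<open>For positive \<open>n\<close>, the extra trace \<open>real n * k \<phi>\<close>, divided
  by \<open>real n\<close> and multiplied by the rescaled screen metric, is exactly the correction
  of the symmetric part. For \<open>n = 0\<close> the division gives 0, but the screen metric
  vanishes.\<close>

lemma tracefree_sym_part_hat:
  assumes p: "p \<in> points" and T: "torsion p \<in> G_minus1 M g K p"
    and V: "V \<in> screen_space M g K p" and W: "W \<in> screen_space M g K p" and k: "k \<in> K p"
  shows "tracefree_sym_part n M ghat K p (screen_part (torsion_hat p)) V W k =
    exp (2 * \<phi> p) * tracefree_sym_part n M g K p (screen_part (torsion p)) V W k"
proof (cases "n = 0")
  case True
  then show ?thesis
    using screen_metric_zero_dim[OF p V W]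
    by (simp add: tracefree_sym_part_def sym_part_hat[OF p V W k])
next
  case False
  then show ?thesis
    unfolding tracefree_sym_part_def sym_part_hat[OF p V W k] screen_trace_hat[OF p T k]
      screen_metric_hat[OF p V W]
    by (simp add: field_simps)
qed

section \<open>Transfer of the subbundles and of their smooth sections\<close>

lemma N1_minus1_hat:
  assumes p: "p \<in> points" and T: "torsion p \<in> N1_minus1 M g K p"
  shows "torsion_hat p \<in> N1_minus1 M ghat K p"
  using T G_minus1_hat[OF p] skew_part_hat[OF p]
  by (simp add: N1_minus1_def screen_space_hat[OF p])

lemma N2_minus1_hat:
  assumes p: "p \<in> points" and T: "torsion p \<in> N2_minus1 n M g K p"
  shows "torsion_hat p \<in> N2_minus1 n M ghat K p"
  using T G_minus1_hat[OF p] tracefree_sym_part_hat[OF p]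
  by (simp add: N2_minus1_def screen_space_hat[OF p])

text \<open>The subbundle enters only through the pointwise assumption \<open>E\<close>, so one
  smoothness argument, read off the torsion formula, serves all three cases.\<close>

lemma G_sections_hat:
  assumes E: "\<And>p. p \<in> points \<Longrightarrow> torsion p \<in> E p \<Longrightarrow> torsion_hat p \<in> Ehat p"
    and T: "torsion \<in> G_sections M g K E"
  shows "torsion_hat \<in> G_sections M ghat K Ehat"
  unfolding G_sections_def
proof (intro CollectI conjI ballI allI impI)
  show "torsion_hat p \<in> Ehat p" if "p \<in> points" for p
    using T that by (intro E) (auto simp: G_sections_def)
  fix U v w k
  assume v: "smooth_vfield M U v" and w': "smooth_section M (K_perp M ghat K) U w"
    and k': "smooth_section M K U k"
  note P = smooth_vfield_points[OF v]
  have U: "openin (space_top M) U" using v by (simp add: smooth_vfield_def)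
  have w: "smooth_vfield M U w" "\<And>q. q \<in> U \<Longrightarrow> w q \<in> K_perp M g K q"
    using w' K_perp_hat[OF P] by (auto simp: smooth_section_def)
  have k: "smooth_vfield M U k" "\<And>q. q \<in> U \<Longrightarrow> k q \<in> K q"
    using k' by (auto simp: smooth_section_def)
  have \<phi>: "smooth_fun M U \<phi>"
    using smooth_factor P U by (auto intro: smooth_fun_subset)
  have app: "smooth_fun M U (\<lambda>q. X q \<phi>)" if "smooth_vfield M U X" for X
    using that \<phi> by (simp add: smooth_vfield_def)
  have met: "smooth_fun M U (\<lambda>q. g q (X q) (Y q))" if "smooth_vfield M U X" "smooth_vfield M U Y" for X Y
    using lorentzian that by (simp add: lorentzian_metric_def)
  have "smooth_section M (K_perp M g K) U w"
    using w by (simp add: smooth_section_def)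
  then have tor: "smooth_fun M U (\<lambda>q. torsion q (v q) (w q +o K q) (k q))"
    using T v k' by (simp add: G_sections_def)
  \<comment> \<open>The difference is written as a sum with \<open>- 1\<close> times a product, to
    match the closure rules for smooth functions.\<close>
  have "smooth_fun M U (\<lambda>q. exp (2 * \<phi> q) * (torsion q (v q) (w q +o K q) (k q) +
      (k q \<phi> * g q (v q) (w q) + (- 1) * (g q (v q) (k q) * w q \<phi>))))"
    by (intro smooth_fun_mult[OF manifold] smooth_fun_add[OF manifold] smooth_fun_exp[OF manifold]
        smooth_fun_const[OF manifold U] \<phi> app met tor v w(1) k(1))
  moreover have "torsion_hat q (v q) (w q +o K q) (k q) = exp (2 * \<phi> q) *
      (torsion q (v q) (w q +o K q) (k q) +
      (k q \<phi> * g q (v q) (w q) + (- 1) * (g q (v q) (k q) * w q \<phi>)))" if "q \<in> U" for q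
    using torsion_hat_eq[OF P[OF that] smooth_vfield_tangent[OF v that] w(2)[OF that] k(2)[OF that]]
    by simp
  ultimately show "smooth_fun M U (\<lambda>q. torsion_hat q (v q) (w q +o K q) (k q))"
    using smooth_fun_cong[OF manifold, of U "\<lambda>q. torsion_hat q (v q) (w q +o K q) (k q)"] by simp
qed

lemma torsion_sections_hat:
  "torsion \<in> G_sections M g K (G_minus1 M g K) \<Longrightarrow>
    torsion_hat \<in> G_sections M ghat K (G_minus1 M ghat K)"
  "torsion \<in> G_sections M g K (N1_minus1 M g K) \<Longrightarrow>
    torsion_hat \<in> G_sections M ghat K (N1_minus1 M ghat K)"
  "torsion \<in> G_sections M g K (N2_minus1 n M g K) \<Longrightarrow>
    torsion_hat \<in> G_sections M ghat K (N2_minus1 n M ghat K)"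
  by (rule G_sections_hat; (assumption | rule G_minus1_hat N1_minus1_hat N2_minus1_hat; assumption))+

end

theorem proposition5p5:
  fixes n :: nat
    and M :: "('a, 'd::finite) charted_space"
    and c :: "'a metric_field set"
    and F K :: "'a \<Rightarrow> 'a tvec set"
    and g ghat :: "'a metric_field"
    and nabla nablahat :: "'a conn"
    and T That :: "'a \<Rightarrow> 'a torsion_form"
  assumes "conformal_optical_geometry n M c F K"
    and "g \<in> c" and "ghat \<in> c"
    and "levi_civita M g nabla" and "levi_civita M ghat nablahat"
    and "T = intrinsic_torsion M g nabla K"
    and "That = intrinsic_torsion M ghat nablahat K"
  shows "(T \<in> G_sections M g K (G_minus1 M g K) \<longleftrightarrow>
            That \<in> G_sections M ghat K (G_minus1 M ghat K)) \<and>
         (T \<in> G_sections M g K (N1_minus1 M g K) \<longleftrightarrow>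
            That \<in> G_sections M ghat K (N1_minus1 M ghat K)) \<and>
         (T \<in> G_sections M g K (N2_minus1 n M g K) \<longleftrightarrow>
            That \<in> G_sections M ghat K (N2_minus1 n M ghat K))"
proof -
  have geom: "CARD('d) = n + 2" "smooth_manifold M" "conformal_class M c" "line_distribution M K"
    and null: "\<And>h p k. h \<in> c \<Longrightarrow> p \<in> topspace (space_top M) \<Longrightarrow> k \<in> K p \<Longrightarrow> h p k k = 0"
    using assms(1) by (auto simp: conformal_optical_geometry_def oriented_manifold_def)
  have lor: "lorentzian_metric M g" "lorentzian_metric M ghat"
    using geom(3)[unfolded conformal_class_def, THEN conjunct2, THEN conjunct1] assms(2,3) by blast+
  \<comment> \<open>Any member of the class can be the reference metric; the equivalence in
    \<open>conformal_class\<close> is read with \<open>g\<close> in that role.\<close>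
  have "\<exists>\<phi>. smooth_fun M (topspace (space_top M)) \<phi> \<and>
      (\<forall>p\<in>topspace (space_top M). \<forall>v\<in>tangent_space M p. \<forall>w\<in>tangent_space M p.
        ghat p v w = exp (2 * \<phi> p) * g p v w)"
    using geom(3)[unfolded conformal_class_def, THEN conjunct2, THEN conjunct2, THEN bspec, OF assms(2),
        THEN spec, THEN iffD1, OF assms(3)] by (rule conjunct2)
  then obtain \<phi> where \<phi>: "smooth_fun M (topspace (space_top M)) \<phi>"
    and conf: "\<And>p v w. p \<in> topspace (space_top M) \<Longrightarrow> v \<in> tangent_space M p \<Longrightarrow> w \<in> tangent_space M p \<Longrightarrow>
      ghat p v w = exp (2 * \<phi> p) * g p v w"
    by (elim exE conjE) simp
  have og: "optical_geometry n M K g" "optical_geometry n M K ghat"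
    using geom lor null assms(2,3) by (auto intro!: optical_geometry.intro)
  interpret fwd: conformal_change n M K g ghat nabla nablahat \<phi>
    using lor assms(4,5) \<phi> conf
    by (intro conformal_change.intro og conformal_change_axioms.intro)
  have "smooth_fun M (topspace (space_top M)) (\<lambda>p. - \<phi> p)"
    using smooth_fun_cmult[OF geom(2) \<phi>, of "- 1"] by simp
  moreover have "g p v w = exp (2 * - \<phi> p) * ghat p v w"
    if "p \<in> topspace (space_top M)" "v \<in> tangent_space M p" "w \<in> tangent_space M p" for p v w
    using conf[OF that] by (simp add: exp_minus)
  ultimately interpret bwd: conformal_change n M K ghat g nablahat nabla "\<lambda>p. - \<phi> p"
    using lor assms(4,5)
    by (intro conformal_change.intro og conformal_change_axioms.intro)
  show ?thesis
    unfolding assms(6,7) using fwd.torsion_sections_hat bwd.torsion_sections_hat by blast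
qed

end
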